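(* Let $(\mathscr{M},g)$ be a four-dimensional Lorentzian manifold with a family $\mathscr{L}$ of parametrized maximal null geodesics as described in the context, and let $h\in C^\infty(\mathscr{M})$ be a strictly positive function with $h\equiv1$ outside a region $\Omega\subset\mathscr{M}$. Consider the conformally changed metric $\tilde g=h\,g$. For $(\gamma,I)\in\mathscr{L}$ let $\tilde\gamma$ be the reparametrized curve $\tilde\gamma(\tilde\tau)=\gamma(\tau)$ with $\frac{d\tilde\tau}{d\tau}=h(\gamma(\tau))$. Then $\tilde\gamma$ is a null geodesic of $(\mathscr{M},\tilde g)$ (affinely parametrized by $\tilde\tau$) with $\dot{\tilde\gamma}=\frac1h\,\dot\gamma$. Moreover, letting $\tilde{\mathscr{L}}$ be the family of all these $\tilde\gamma$, for every $p\in\mathscr{M}$ one has $$D_p\tilde{\mathscr{L}}=\Big\{\tfrac{u}{h(p)} : u\in D_p\mathscr{L}\Big\},\qquad \tilde\mu_p\big(D_p\tilde{\mathscr{L}}\big)=h(p)\,\mu_p\big(D_p\tilde{\mathscr{L}}\big)=\frac1{h(p)}\,\mu_p\big(D_p\mathscr{L}\big),$$ $$\tilde\kappa_{\mathrm{vol}}(p)=h(p)\,\kappa_{\mathrm{vol}}(p)\qquad\text{and}\qquad\tilde\kappa(p)=h(p)\,\kappa(p),$$ where quantities with a tilde are formed with $\tilde g$ and $\tilde{\mathscr{L}}$.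
   Context: Signature is $(+,-,-,-)$. $\mathscr{L}$ is a set of parametrized (affinely, $\nabla_\tau\dot\gamma=0$) maximal null geodesics $(\gamma,I)$, $\gamma:I\to\mathscr{M}$, such that (a) $\mathscr{L}$ is invariant under additive reparametrizations $\gamma(\tau)\mapsto\gamma(\tau+c)$ and orientation reversal $\gamma(\tau)\mapsto\gamma(-\tau)$; (b) for every maximal null geodesic $\gamma$ there is exactly one $\lambda>0$ such that $\tau\mapsto\gamma(\lambda\tau)$ belongs to $\mathscr{L}$. Set $D_p\mathscr{L}=\{\dot\gamma(\tau) : (\gamma,I)\in\mathscr{L},\ \tau\in I,\ \gamma(\tau)=p\}\subset T_p\mathscr{M}$, assumed to be a smooth two-dimensional surface in the light cone of $T_p\mathscr{M}$. The Lorentzian inner product on $T_p\mathscr{M}$ induces (up to sign) a Riemannian metric on $D_p\mathscr{L}$; $\mu_p$ is its volume measure and $K_p$ its Gaussian curvature. The expression $\mu_p(D_p\tilde{\mathscr{L}})$ denotes the volume of $D_p\tilde{\mathscr{L}}$ with respect to the metric induced by $g_p$, and $\tilde\mu_p(D_p\tilde{\mathscr{L}})$ the volume with respect to the metric induced by $\tilde g_p$. The DGC functions are defined by $$\frac1{\kappa(p)}=\frac{8\pi}{\mu_p(D_p\mathscr{L})}\int_{D_p\mathscr{L}}\frac{d\mu_p(x)}{K_p(x)},\qquad\frac1{\kappa_{\mathrm{vol}}(p)}=\mu_p(D_p\mathscr{L}).$$ *)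

theory Defs
  imports "HOL-Analysis.Analysis"
begin

section \<open>Smooth maps between normed spaces\<close>

text \<open>Used only on open sets \<open>S\<close>.\<close>

fun Ck_on :: "nat \<Rightarrow> 'a::real_normed_vector set \<Rightarrow> ('a \<Rightarrow> 'b::real_normed_vector) \<Rightarrow> bool" where
  "Ck_on 0 S f \<longleftrightarrow> continuous_on S f"
| "Ck_on (Suc n) S f \<longleftrightarrow>
     (\<forall>x\<in>S. f differentiable (at x)) \<and> (\<forall>v. Ck_on n S (\<lambda>x. frechet_derivative f (at x) v))"

definition smooth_on :: "'a::real_normed_vector set \<Rightarrow> ('a \<Rightarrow> 'b::real_normed_vector) \<Rightarrow> bool" where
  "smooth_on S f \<longleftrightarrow> (\<forall>n. Ck_on n S f)"


section \<open>Metrics in coordinates: Christoffel symbols and curvature\<close>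

text \<open>A (pseudo-)Riemannian metric on an open subset of Euclidean space is given by its matrix
  of components. The index \<open>'n\<close> is \<open>4\<close> for spacetime and \<open>2\<close> for surfaces.\<close>

definition pderiv_at :: "'n::finite \<Rightarrow> (real^'n \<Rightarrow> real) \<Rightarrow> real^'n \<Rightarrow> real" where
  "pderiv_at i f x = frechet_derivative f (at x) (axis i 1)"

definition christoffel ::
    "(real^'n \<Rightarrow> real^'n^'n) \<Rightarrow> 'n::finite \<Rightarrow> 'n \<Rightarrow> 'n \<Rightarrow> real^'n \<Rightarrow> real" where
  "christoffel G k i j x = (\<Sum>l\<in>UNIV. matrix_inv (G x) $ k $ l *
     (pderiv_at i (\<lambda>y. G y $ j $ l) x + pderiv_at j (\<lambda>y. G y $ i $ l) x
       - pderiv_at l (\<lambda>y. G y $ i $ j) x)) / 2"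

text \<open>Sign convention: \<open>R(\<partial>\<^sub>i,\<partial>\<^sub>j)\<partial>\<^sub>k = \<Sum>\<^sub>l R\<^sup>l\<^sub>k\<^sub>i\<^sub>j \<partial>\<^sub>l\<close> with
  \<open>R(X,Y)Z = \<nabla>\<^sub>X\<nabla>\<^sub>YZ - \<nabla>\<^sub>Y\<nabla>\<^sub>XZ - \<nabla>\<^bsub>[X,Y]\<^esub>Z\<close>; the argument order below is \<open>l k i j\<close>.\<close>

definition riemann ::
    "(real^'n \<Rightarrow> real^'n^'n) \<Rightarrow> 'n::finite \<Rightarrow> 'n \<Rightarrow> 'n \<Rightarrow> 'n \<Rightarrow> real^'n \<Rightarrow> real" where
  "riemann G l k i j x =
     pderiv_at i (christoffel G l j k) x - pderiv_at j (christoffel G l i k) x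
     + (\<Sum>m\<in>UNIV. christoffel G l i m x * christoffel G m j k x
                 - christoffel G l j m x * christoffel G m i k x)"

text \<open>\<open>K = \<langle>R(\<partial>\<^sub>1,\<partial>\<^sub>2)\<partial>\<^sub>2, \<partial>\<^sub>1\<rangle> / det G\<close>, which is \<open>1\<close> for the unit sphere.\<close>

definition gauss_curv_coord :: "(real^2 \<Rightarrow> real^2^2) \<Rightarrow> real^2 \<Rightarrow> real" where
  "gauss_curv_coord G x = (\<Sum>l\<in>UNIV. G x $ 1 $ l * riemann G l 2 1 2 x) / det (G x)"


section \<open>Four-dimensional manifolds and their tangent spaces\<close>

text \<open>A chart is a pair of a domain and a coordinate map; the values of the coordinate map
  outside the domain are irrelevant. The manifold is the whole type \<open>'m\<close>.\<close>

type_synonym 'm chart = "'m set \<times> ('m \<Rightarrow> real^4)"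

definition chart_inv :: "'m chart \<Rightarrow> real^4 \<Rightarrow> 'm" where
  "chart_inv c = inv_into (fst c) (snd c)"

definition is_chart :: "'m::topological_space chart \<Rightarrow> bool" where
  "is_chart c \<longleftrightarrow> open (fst c) \<and> open (snd c ` fst c)
     \<and> homeomorphism (fst c) (snd c ` fst c) (snd c) (chart_inv c)"

definition smooth_atlas :: "'m::{t2_space, second_countable_topology} chart set \<Rightarrow> bool" where
  "smooth_atlas A \<longleftrightarrow> (\<forall>c\<in>A. is_chart c) \<and> (\<Union>c\<in>A. fst c) = UNIV
     \<and> (\<forall>c\<in>A. \<forall>d\<in>A. smooth_on (snd c ` (fst c \<inter> fst d)) (snd d \<circ> chart_inv c))"

definition charts_at :: "'m chart set \<Rightarrow> 'm \<Rightarrow> 'm chart set" where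
  "charts_at A p = {c\<in>A. p \<in> fst c}"

definition smooth_fun :: "'m chart set \<Rightarrow> ('m \<Rightarrow> real) \<Rightarrow> bool" where
  "smooth_fun A f \<longleftrightarrow> (\<forall>c\<in>A. smooth_on (snd c ` fst c) (f \<circ> chart_inv c))"

text \<open>A tangent vector at \<open>p\<close> is the family of its components in the charts around \<open>p\<close>,
  transforming by the derivatives of the coordinate changes. It is set to \<open>0\<close> at all other
  charts, so that the vector space structure and the topology of the tangent space are the
  pointwise ones.\<close>

type_synonym 'm tangent = "'m chart \<Rightarrow> real^4"

definition coord_change :: "'m chart \<Rightarrow> 'm chart \<Rightarrow> 'm \<Rightarrow> real^4 \<Rightarrow> real^4" where
  "coord_change c d p = frechet_derivative (snd d \<circ> chart_inv c) (at (snd c p))"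

definition tangent_space :: "'m chart set \<Rightarrow> 'm \<Rightarrow> 'm tangent set" where
  "tangent_space A p = {v. (\<forall>c. c \<notin> charts_at A p \<longrightarrow> v c = 0)
     \<and> (\<forall>c\<in>charts_at A p. \<forall>d\<in>charts_at A p. v d = coord_change c d p (v c))}"

definition tscale :: "real \<Rightarrow> 'm tangent \<Rightarrow> 'm tangent" where
  "tscale a v = (\<lambda>c. a *\<^sub>R v c)"

definition tadd :: "'m tangent \<Rightarrow> 'm tangent \<Rightarrow> 'm tangent" where
  "tadd u v = (\<lambda>c. u c + v c)"

definition tangent_of_coord :: "'m chart set \<Rightarrow> 'm chart \<Rightarrow> 'm \<Rightarrow> real^4 \<Rightarrow> 'm tangent" where
  "tangent_of_coord A c p w =
     (\<lambda>d. if d \<in> charts_at A p then coord_change c d p w else 0)"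


section \<open>Lorentzian metrics and null geodesics\<close>

text \<open>Only the values \<open>g p u v\<close> for \<open>u\<close>, \<open>v\<close> tangent at \<open>p\<close> are relevant.\<close>

type_synonym 'm metric = "'m \<Rightarrow> 'm tangent \<Rightarrow> 'm tangent \<Rightarrow> real"

definition metric_coord ::
    "'m chart set \<Rightarrow> 'm metric \<Rightarrow> 'm chart \<Rightarrow> real^4 \<Rightarrow> real^4^4" where
  "metric_coord A g c x = (let p = chart_inv c x in
     (\<chi> i j. g p (tangent_of_coord A c p (axis i 1)) (tangent_of_coord A c p (axis j 1))))"

definition lorentzian_manifold ::
    "'m::{t2_space, second_countable_topology} chart set \<Rightarrow> 'm metric \<Rightarrow> bool" where
  "lorentzian_manifold A g \<longleftrightarrow> smooth_atlas A
     \<and> (\<forall>p. \<forall>u\<in>tangent_space A p. \<forall>v\<in>tangent_space A p. g p u v = g p v u)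
     \<and> (\<forall>p. \<forall>u\<in>tangent_space A p. \<forall>v\<in>tangent_space A p. \<forall>w\<in>tangent_space A p. \<forall>a b.
          g p (tadd (tscale a u) (tscale b v)) w = a * g p u w + b * g p v w)
     \<and> (\<forall>p. \<exists>e :: 4 \<Rightarrow> 'm tangent. (\<forall>i. e i \<in> tangent_space A p)
          \<and> (\<forall>i j. g p (e i) (e j) = (if i \<noteq> j then 0 else if i = 0 then 1 else -1)))
     \<and> (\<forall>c\<in>A. \<forall>i j. smooth_on (snd c ` fst c) (\<lambda>x. metric_coord A g c x $ i $ j))"

definition conformal :: "('m \<Rightarrow> real) \<Rightarrow> 'm metric \<Rightarrow> 'm metric" where
  "conformal h g = (\<lambda>p u v. h p * g p u v)"

text \<open>A parametrized curve is a map together with its parameter interval; the map is required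
  to be \<open>extensional\<close> on the interval, so that equality of curves is equality of pairs.\<close>

type_synonym 'm curve = "(real \<Rightarrow> 'm) \<times> real set"

definition smooth_curve :: "'m::topological_space chart set \<Rightarrow> 'm curve \<Rightarrow> bool" where
  "smooth_curve A = (\<lambda>(\<gamma>, I). I \<noteq> {} \<and> open I \<and> is_interval I \<and> \<gamma> \<in> extensional I
     \<and> continuous_on I \<gamma> \<and> (\<forall>c\<in>A. smooth_on {\<tau>\<in>I. \<gamma> \<tau> \<in> fst c} (snd c \<circ> \<gamma>)))"

definition velocity :: "'m chart set \<Rightarrow> (real \<Rightarrow> 'm) \<Rightarrow> real \<Rightarrow> 'm tangent" where
  "velocity A \<gamma> \<tau> = (\<lambda>c. if c \<in> charts_at A (\<gamma> \<tau>)
     then vector_derivative (snd c \<circ> \<gamma>) (at \<tau>) else 0)"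

text \<open>Affinely parametrized geodesics: \<open>\<nabla>\<^sub>\<tau>\<gamma>' = 0\<close> in all charts.\<close>

definition geodesic ::
    "'m::topological_space chart set \<Rightarrow> 'm metric \<Rightarrow> 'm curve \<Rightarrow> bool" where
  "geodesic A g = (\<lambda>(\<gamma>, I). smooth_curve A (\<gamma>, I)
     \<and> (\<forall>\<tau>\<in>I. \<forall>c\<in>charts_at A (\<gamma> \<tau>). \<forall>k.
          vector_derivative (\<lambda>t. vector_derivative (snd c \<circ> \<gamma>) (at t)) (at \<tau>) $ k
          + (\<Sum>i\<in>UNIV. \<Sum>j\<in>UNIV. christoffel (metric_coord A g c) k i j (snd c (\<gamma> \<tau>))
               * velocity A \<gamma> \<tau> c $ i * velocity A \<gamma> \<tau> c $ j) = 0))"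

definition light_cone :: "'m chart set \<Rightarrow> 'm metric \<Rightarrow> 'm \<Rightarrow> 'm tangent set" where
  "light_cone A g p = {u \<in> tangent_space A p. u \<noteq> (\<lambda>c. 0) \<and> g p u u = 0}"

text \<open>Constant curves are excluded, since the zero vector is not in the light cone.\<close>

definition null_geodesic ::
    "'m::topological_space chart set \<Rightarrow> 'm metric \<Rightarrow> 'm curve \<Rightarrow> bool" where
  "null_geodesic A g = (\<lambda>(\<gamma>, I). geodesic A g (\<gamma>, I)
     \<and> (\<forall>\<tau>\<in>I. velocity A \<gamma> \<tau> \<in> light_cone A g (\<gamma> \<tau>)))"

definition maximal_null_geodesic ::
    "'m::topological_space chart set \<Rightarrow> 'm metric \<Rightarrow> 'm curve \<Rightarrow> bool" where
  "maximal_null_geodesic A g = (\<lambda>(\<gamma>, I). null_geodesic A g (\<gamma>, I)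
     \<and> (\<forall>\<gamma>' I'. geodesic A g (\<gamma>', I') \<and> I \<subseteq> I' \<and> (\<forall>\<tau>\<in>I. \<gamma>' \<tau> = \<gamma> \<tau>) \<longrightarrow> I' = I))"

definition affine_reparam :: "real \<Rightarrow> real \<Rightarrow> 'm curve \<Rightarrow> 'm curve" where
  "affine_reparam a b = (\<lambda>(\<gamma>, I). let J = {\<tau>. a * \<tau> + b \<in> I} in
     (restrict (\<lambda>\<tau>. \<gamma> (a * \<tau> + b)) J, J))"

definition velocity_set :: "'m chart set \<Rightarrow> 'm curve set \<Rightarrow> 'm \<Rightarrow> 'm tangent set" where
  "velocity_set A L p = {velocity A \<gamma> \<tau> | \<gamma> I \<tau>. (\<gamma>, I) \<in> L \<and> \<tau> \<in> I \<and> \<gamma> \<tau> = p}"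


section \<open>Surfaces in a tangent space\<close>

definition tderiv :: "(real^2 \<Rightarrow> 'm tangent) \<Rightarrow> real^2 \<Rightarrow> real^2 \<Rightarrow> 'm tangent" where
  "tderiv F x w = (\<lambda>c. frechet_derivative (\<lambda>y. F y c) (at x) w)"

text \<open>Local parametrizations of \<open>S\<close> as an embedded surface in the tangent space at \<open>p\<close>.\<close>

definition local_param ::
    "'m chart set \<Rightarrow> 'm \<Rightarrow> 'm tangent set \<Rightarrow> (real^2) set \<Rightarrow> (real^2 \<Rightarrow> 'm tangent) \<Rightarrow> bool" where
  "local_param A p S U F \<longleftrightarrow> open U
     \<and> (\<forall>c\<in>charts_at A p. smooth_on U (\<lambda>x. F x c))
     \<and> (\<forall>x\<in>U. \<forall>w. tderiv F x w = (\<lambda>c. 0) \<longrightarrow> w = 0)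
     \<and> F ` U \<subseteq> S \<and> openin (top_of_set S) (F ` U) \<and> (\<exists>G. homeomorphism U (F ` U) F G)"

definition smooth_surface :: "'m chart set \<Rightarrow> 'm \<Rightarrow> 'm tangent set \<Rightarrow> bool" where
  "smooth_surface A p S \<longleftrightarrow> S \<subseteq> tangent_space A p
     \<and> (\<forall>u\<in>S. \<exists>U F. local_param A p S U F \<and> u \<in> F ` U)"

text \<open>In signature \<open>(+,-,-,-)\<close> the induced metric is \<open>-b\<close> restricted to the tangent
  planes, where \<open>b\<close> is the Lorentzian inner product.\<close>

definition induces_riemannian ::
    "'m chart set \<Rightarrow> 'm \<Rightarrow> ('m tangent \<Rightarrow> 'm tangent \<Rightarrow> real) \<Rightarrow> 'm tangent set \<Rightarrow> bool" where
  "induces_riemannian A p b S \<longleftrightarrow> (\<forall>U F. local_param A p S U F \<longrightarrow>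
     (\<forall>x\<in>U. \<forall>w. w \<noteq> 0 \<longrightarrow> - b (tderiv F x w) (tderiv F x w) > 0))"

definition first_form ::
    "('m tangent \<Rightarrow> 'm tangent \<Rightarrow> real) \<Rightarrow> (real^2 \<Rightarrow> 'm tangent) \<Rightarrow> real^2 \<Rightarrow> real^2^2" where
  "first_form b F x = (\<chi> i j. - b (tderiv F x (axis i 1)) (tderiv F x (axis j 1)))"

text \<open>The volume measure is the unique Borel measure on \<open>S\<close> that is given by the area density
  in every local parametrization. The Gaussian curvature at \<open>u\<close> is the common value obtained
  from all local parametrizations around \<open>u\<close>. For a smooth surface with induced Riemannian
  metric both descriptions determine exactly one object; the default values in the
  \<open>else\<close> branches are then irrelevant.\<close>

definition volume_measures ::
    "'m chart set \<Rightarrow> 'm \<Rightarrow> ('m tangent \<Rightarrow> 'm tangent \<Rightarrow> real) \<Rightarrow> 'm tangent set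
      \<Rightarrow> 'm tangent measure set" where
  "volume_measures A p b S = {\<mu>. space \<mu> = S \<and> sets \<mu> = sets (restrict_space borel S)
     \<and> (\<forall>U F B. local_param A p S U F \<and> B \<in> sets borel \<and> B \<subseteq> U \<longrightarrow>
          emeasure \<mu> (F ` B) = (\<integral>\<^sup>+x\<in>B. ennreal (sqrt (det (first_form b F x))) \<partial>lborel))}"

definition volume_measure ::
    "'m chart set \<Rightarrow> 'm \<Rightarrow> ('m tangent \<Rightarrow> 'm tangent \<Rightarrow> real) \<Rightarrow> 'm tangent set
      \<Rightarrow> 'm tangent measure" where
  "volume_measure A p b S = (if is_singleton (volume_measures A p b S)
     then the_elem (volume_measures A p b S) else null_measure (restrict_space borel S))"

definition gauss_values ::
    "'m chart set \<Rightarrow> 'm \<Rightarrow> ('m tangent \<Rightarrow> 'm tangent \<Rightarrow> real) \<Rightarrow> 'm tangent set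
      \<Rightarrow> 'm tangent \<Rightarrow> real set" where
  "gauss_values A p b S u = {gauss_curv_coord (first_form b F) x | U F x.
     local_param A p S U F \<and> x \<in> U \<and> F x = u}"

definition gauss_curvature ::
    "'m chart set \<Rightarrow> 'm \<Rightarrow> ('m tangent \<Rightarrow> 'm tangent \<Rightarrow> real) \<Rightarrow> 'm tangent set
      \<Rightarrow> 'm tangent \<Rightarrow> real" where
  "gauss_curvature A p b S u = (if is_singleton (gauss_values A p b S u)
     then the_elem (gauss_values A p b S u) else 0)"


section \<open>Families of null geodesics and DGC functions\<close>

definition geodesic_family ::
    "'m::topological_space chart set \<Rightarrow> 'm metric \<Rightarrow> 'm curve set \<Rightarrow> bool" where
  "geodesic_family A g L \<longleftrightarrow> (\<forall>\<gamma>\<in>L. maximal_null_geodesic A g \<gamma>)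
     \<and> (\<forall>\<gamma>\<in>L. \<forall>c. affine_reparam 1 c \<gamma> \<in> L)
     \<and> (\<forall>\<gamma>\<in>L. affine_reparam (-1) 0 \<gamma> \<in> L)
     \<and> (\<forall>\<gamma>. maximal_null_geodesic A g \<gamma> \<longrightarrow> (\<exists>!l. l > 0 \<and> affine_reparam l 0 \<gamma> \<in> L))
     \<and> (\<forall>p. smooth_surface A p (velocity_set A L p)
          \<and> velocity_set A L p \<subseteq> light_cone A g p
          \<and> induces_riemannian A p (g p) (velocity_set A L p))"

definition vol :: "'m chart set \<Rightarrow> 'm metric \<Rightarrow> 'm curve set \<Rightarrow> 'm \<Rightarrow> real" where
  "vol A g L p = measure (volume_measure A p (g p) (velocity_set A L p)) (velocity_set A L p)"

definition kappa_vol :: "'m chart set \<Rightarrow> 'm metric \<Rightarrow> 'm curve set \<Rightarrow> 'm \<Rightarrow> real" where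
  "kappa_vol A g L p = 1 / vol A g L p"

definition kappa :: "'m chart set \<Rightarrow> 'm metric \<Rightarrow> 'm curve set \<Rightarrow> 'm \<Rightarrow> real" where
  "kappa A g L p = 1 / (8 * pi / vol A g L p *
     (\<integral>u. 1 / gauss_curvature A p (g p) (velocity_set A L p) u
        \<partial>volume_measure A p (g p) (velocity_set A L p)))"

text \<open>\<open>\<gamma>'(s(\<tau>)) = \<gamma>(\<tau>)\<close> with \<open>ds/d\<tau> = h(\<gamma>(\<tau>))\<close>; the parameter change
  \<open>s\<close> is determined up to an additive constant, and all choices are admitted.\<close>

definition conformal_reparam ::
    "('m \<Rightarrow> real) \<Rightarrow> (real \<Rightarrow> real) \<Rightarrow> 'm curve \<Rightarrow> 'm curve \<Rightarrow> bool" where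
  "conformal_reparam h s = (\<lambda>(\<gamma>, I) (\<gamma>', I').
     (\<forall>\<tau>\<in>I. (s has_real_derivative h (\<gamma> \<tau>)) (at \<tau>))
     \<and> I' = s ` I \<and> \<gamma>' \<in> extensional I' \<and> (\<forall>\<tau>\<in>I. \<gamma>' (s \<tau>) = \<gamma> \<tau>))"

definition conformal_family :: "('m \<Rightarrow> real) \<Rightarrow> 'm curve set \<Rightarrow> 'm curve set" where
  "conformal_family h L = {\<gamma>'. \<exists>\<gamma>\<in>L. \<exists>s. conformal_reparam h s \<gamma> \<gamma>'}"

end

theory Submission
  imports Defs
begin

text \<open>For a conformal factor \<open>h\<close> the Christoffel symbols of \<open>h g\<close> differ from those of \<open>g\<close> by
  \<open>(\<delta>\<^sup>k\<^sub>j \<partial>\<^sub>i h + \<delta>\<^sup>k\<^sub>i \<partial>\<^sub>j h - g\<^sub>i\<^sub>j g\<^sup>k\<^sup>l \<partial>\<^sub>l h) / (2 h)\<close>. Contracted with a null vector \<open>v\<close> the last term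
  vanishes and \<open>(dh(v) / h) v\<close> remains, which is exactly cancelled by the acceleration that the
  reparametrization \<open>d\<tau>'/d\<tau> = h\<close> produces. Velocities are therefore divided by \<open>h\<close>. On a fixed tangent
  space, scaling the surface by \<open>a\<close> and the inner product by \<open>k\<close> multiplies the first fundamental form
  of every local parametrization by the constant \<open>k a\<^sup>2\<close>; hence areas are multiplied and Gaussian
  curvatures divided by \<open>k a\<^sup>2\<close>. With \<open>k = h\<close> and \<open>a = 1/h\<close> this factor is \<open>1/h\<close>.\<close>

section \<open>Calculus of \<open>C\<^sup>k\<close> maps\<close>

text \<open>The obstacle is that area measure and Gaussian curvature are defined as the unique
  element of a set of candidates, with a default value otherwise. Existence and uniqueness of such
  elements are never established here. Instead, scaling is shown to act bijectively on the
  candidates, so uniqueness holds before scaling exactly when it holds after it, and the defaults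
  (the null measure and 0) are compatible with scaling too. In the same spirit, the identities for
  integrals, areas and quotients cover the value 0 that HOL assigns to non-integrable functions,
  infinite measures and division by zero.

  The constants of the theorem come from one scaling lemma for areas. With k = h(p), a = 1/h(p) it
  compares the area for the new metric with the original area; with k = 1, a = 1/h(p) it gives the
  factor 1/h(p)^2 for the rescaled surface measured by the old metric. In 1/kappa the area in the
  denominator contributes h(p), while the measure and 1/K contribute 1/h(p) each; what remains is
  1/h(p).\<close>

lemma frechet_derivative_cong_open:
  assumes "open S" "x \<in> S" "\<And>y. y \<in> S \<Longrightarrow> f y = g y"
  shows "frechet_derivative f (at x) = frechet_derivative g (at x)"
proof -
  \<comment> \<open>\<open>frechet_derivative\<close> is a choice among all derivatives at the
    point. If both functions have the same derivatives, the choices agree, even where there is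
    none.\<close>
  have "(f has_derivative f') (at x) \<longleftrightarrow> (g has_derivative f') (at x)" for f'
    using has_derivative_transform_within_open[OF _ assms(1,2), of f f' UNIV g]
      has_derivative_transform_within_open[OF _ assms(1,2), of g f' UNIV f] assms(3) by auto
  then show ?thesis
    unfolding frechet_derivative_def by presburger
qed

lemma frechet_derivative_eqI:
  "(f has_derivative f') (at x) \<Longrightarrow> frechet_derivative f (at x) = f'"
  by (rule frechet_derivative_at [symmetric])

lemma differentiable_cong_open:
  assumes "open S" "x \<in> S" "\<And>y. y \<in> S \<Longrightarrow> f y = g y"
  shows "f differentiable (at x) \<longleftrightarrow> g differentiable (at x)"
  using has_derivative_transform_within_open[OF _ assms(1,2), of f _ UNIV g]
      has_derivative_transform_within_open[OF _ assms(1,2), of g _ UNIV f] assms(3)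
  unfolding differentiable_def by metis

lemma Ck_on_cong:
  assumes "open S" "\<And>x. x \<in> S \<Longrightarrow> f x = g x"
  shows "Ck_on n S f \<longleftrightarrow> Ck_on n S g"
  using assms(2)
proof (induction n arbitrary: f g)
  case 0
  then show ?case by (simp cong: continuous_on_cong)
next
  case (Suc n)
  have "Ck_on n S (\<lambda>x. frechet_derivative f (at x) v) \<longleftrightarrow> Ck_on n S (\<lambda>x. frechet_derivative g (at x) v)" for v
    by (rule Suc.IH) (metis frechet_derivative_cong_open[OF assms(1)] Suc.prems)
  moreover have "(\<forall>x\<in>S. f differentiable (at x)) \<longleftrightarrow> (\<forall>x\<in>S. g differentiable (at x))"
    using differentiable_cong_open[of S _ f g] assms(1) Suc.prems by blast
  ultimately show ?case by simp
qed

text \<open>Trades the chosen \<open>frechet_derivative\<close> for an explicit formula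
  \<open>f'\<close>; each closure property below is an induction that feeds its differentiation rule
  into this one.\<close>

lemma Ck_on_SucI:
  assumes "open S" "\<And>x. x \<in> S \<Longrightarrow> (f has_derivative f' x) (at x)" "\<And>v. Ck_on n S (\<lambda>x. f' x v)"
  shows "Ck_on (Suc n) S f"
proof -
  have "Ck_on n S (\<lambda>x. frechet_derivative f (at x) v)" for v
    using assms(3)[of v] Ck_on_cong[OF assms(1), of "\<lambda>x. frechet_derivative f (at x) v" "\<lambda>x. f' x v" n]
      frechet_derivative_eqI[OF assms(2)] by simp
  then show ?thesis
    using assms(2) by (auto simp: differentiable_def)
qed

lemma Ck_on_SucD:
  assumes "Ck_on (Suc n) S f"
  shows "x \<in> S \<Longrightarrow> (f has_derivative frechet_derivative f (at x)) (at x)"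
    and "Ck_on n S (\<lambda>x. frechet_derivative f (at x) v)"
  using assms frechet_derivative_works by auto

text \<open>Differentiating a product, quotient or composite leaves some factors undifferentiated,
  and the induction needs those at the lower order as well.\<close>

lemma Ck_on_lower: "Ck_on (Suc n) S f \<Longrightarrow> Ck_on n S f"
proof (induction n arbitrary: f)
  case 0
  then show ?case
    by (auto intro!: differentiable_imp_continuous_on simp: differentiable_on_def differentiable_at_withinI)
next
  case (Suc n)
  then show ?case by (metis Ck_on.simps(2))
qed

lemma Ck_on_const: "open S \<Longrightarrow> Ck_on n S (\<lambda>x. c)"
proof (induction n arbitrary: c)
  case (Suc n)
  then show ?case by (intro Ck_on_SucI[where f' = "\<lambda>x v. 0"]) auto
qed simp

lemma Ck_on_add: "open S \<Longrightarrow> Ck_on n S f \<Longrightarrow> Ck_on n S g \<Longrightarrow> Ck_on n S (\<lambda>x. f x + g x)"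
proof (induction n arbitrary: f g)
  case 0 then show ?case by (simp add: continuous_on_add)
next
  case (Suc n)
  show ?case
    by (rule Ck_on_SucI[OF Suc.prems(1) has_derivative_add
          [OF Ck_on_SucD(1)[OF Suc.prems(2)] Ck_on_SucD(1)[OF Suc.prems(3)]]])
       (auto intro!: Suc.IH Suc.prems(1) Ck_on_SucD(2)[OF Suc.prems(2)] Ck_on_SucD(2)[OF Suc.prems(3)])
qed

lemma Ck_on_sum:
  assumes "open S" "\<And>i. i \<in> J \<Longrightarrow> Ck_on n S (f i)"
  shows "Ck_on n S (\<lambda>x. \<Sum>i\<in>J. f i x)"
  using assms(2)
  by (induction J rule: infinite_finite_induct) (auto intro!: Ck_on_const Ck_on_add assms(1))

lemma (in bounded_bilinear) Ck_on_prod: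
  "open S \<Longrightarrow> Ck_on n S f \<Longrightarrow> Ck_on n S g \<Longrightarrow> Ck_on n S (\<lambda>x. prod (f x) (g x))"
proof (induction n arbitrary: f g)
  case 0 then show ?case by (simp add: continuous_on)
next
  case (Suc n)
  show ?case
    by (rule Ck_on_SucI[OF Suc.prems(1) FDERIV
          [OF Ck_on_SucD(1)[OF Suc.prems(2)] Ck_on_SucD(1)[OF Suc.prems(3)]]])
       (auto intro!: Suc.IH Ck_on_add Suc.prems(1) Ck_on_SucD(2)[OF Suc.prems(2)]
           Ck_on_SucD(2)[OF Suc.prems(3)] Ck_on_lower[OF Suc.prems(2)] Ck_on_lower[OF Suc.prems(3)])
qed

lemmas Ck_on_scaleR = bounded_bilinear.Ck_on_prod[OF bounded_bilinear_scaleR]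
lemmas Ck_on_mult = bounded_bilinear.Ck_on_prod[OF bounded_bilinear_mult]
lemmas Ck_on_inner = bounded_bilinear.Ck_on_prod[OF bounded_bilinear_inner]

lemma Ck_on_inverse:
  fixes f :: "'a::real_normed_vector \<Rightarrow> real"
  assumes "open S" "\<And>x. x \<in> S \<Longrightarrow> f x \<noteq> 0"
  shows "Ck_on n S f \<Longrightarrow> Ck_on n S (\<lambda>x. inverse (f x))"
proof (induction n)
  case 0 then show ?case using assms by (simp add: continuous_on_inverse)
next
  case (Suc n)
  have *: "((\<lambda>x. inverse (f x)) has_derivative
     (\<lambda>v. inverse (f x) * frechet_derivative f (at x) v * (- 1 * inverse (f x)))) (at x)" if "x \<in> S" for x
    using Deriv.has_derivative_inverse[OF assms(2)[OF that] Ck_on_SucD(1)[OF Suc.prems that]] by simp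
  show ?case
    by (rule Ck_on_SucI[OF assms(1) *])
       (assumption, intro Ck_on_mult Ck_on_const assms(1) Suc.IH Ck_on_SucD(2)[OF Suc.prems] Ck_on_lower[OF Suc.prems])
qed

text \<open>By the chain rule, the derivative of \<open>g\<close> is evaluated in a direction that
  itself depends on the point, whereas \<open>Ck_on\<close> only controls derivatives in fixed
  directions. Expanding that direction in the basis of the Euclidean space leaves fixed directions
  with varying coefficients.\<close>

lemma Ck_on_compose:
  fixes f :: "'a::real_normed_vector \<Rightarrow> 'b::euclidean_space"
  assumes "open S" "f ` S \<subseteq> T"
  shows "Ck_on n S f \<Longrightarrow> Ck_on n T g \<Longrightarrow> Ck_on n S (\<lambda>x. g (f x))"
proof (induction n arbitrary: g)
  case 0 then show ?case using assms by (auto intro: continuous_on_compose2)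
next
  case (Suc n)
  have *: "((\<lambda>x. g (f x)) has_derivative (\<lambda>v. \<Sum>b\<in>Basis. (frechet_derivative f (at x) v \<bullet> b) *\<^sub>R
      frechet_derivative g (at (f x)) b)) (at x)" if "x \<in> S" for x
  proof -
    have g: "(g has_derivative frechet_derivative g (at (f x))) (at (f x))"
      using Ck_on_SucD(1)[OF Suc.prems(2)] that assms(2) by blast
    have l: "frechet_derivative g (at (f x)) w = (\<Sum>b\<in>Basis. (w \<bullet> b) *\<^sub>R frechet_derivative g (at (f x)) b)" for w
    proof -
      have "linear (frechet_derivative g (at (f x)))"
        using g has_derivative_linear by blast
      from linear_sum[OF this, of "\<lambda>b. (w \<bullet> b) *\<^sub>R b" Basis] linear_scale[OF this]
      show ?thesis by (simp add: euclidean_representation)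
    qed
    show ?thesis
      by (subst l [symmetric]) (use diff_chain_at[OF Ck_on_SucD(1)[OF Suc.prems(1) that] g] in \<open>simp add: o_def\<close>)
  qed
  show ?case
  proof (rule Ck_on_SucI[OF assms(1) *], assumption)
    fix v
    have "Ck_on n S (\<lambda>x. frechet_derivative g (at (f x)) b)" for b
      by (rule Suc.IH[OF Ck_on_lower[OF Suc.prems(1)] Ck_on_SucD(2)[OF Suc.prems(2)]])
    then show "Ck_on n S (\<lambda>x. \<Sum>b\<in>Basis. (frechet_derivative f (at x) v \<bullet> b) *\<^sub>R
      frechet_derivative g (at (f x)) b)"
      by (intro Ck_on_sum Ck_on_scaleR Ck_on_inner Ck_on_const assms(1) Ck_on_SucD(2)[OF Suc.prems(1)])
  qed
qed

section \<open>Smooth maps: derivatives, composition, inversion and flows\<close>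

lemma smooth_on_imp_has_derivative:
  assumes "smooth_on S f" "x \<in> S"
  shows "(f has_derivative frechet_derivative f (at x)) (at x)"
  using assms Ck_on_SucD(1)[of 0] unfolding smooth_on_def by blast

lemma smooth_on_imp_differentiable: "smooth_on S f \<Longrightarrow> x \<in> S \<Longrightarrow> f differentiable (at x)"
  using smooth_on_imp_has_derivative differentiable_def by blast

lemma smooth_on_frechet_derivative:
  "smooth_on S f \<Longrightarrow> smooth_on S (\<lambda>x. frechet_derivative f (at x) v)"
  unfolding smooth_on_def using Ck_on_SucD(2) by blast

lemma smooth_on_cong:
  assumes "open S" "\<And>x. x \<in> S \<Longrightarrow> f x = g x"
  shows "smooth_on S f \<longleftrightarrow> smooth_on S g"
  unfolding smooth_on_def using Ck_on_cong[OF assms] by simp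

lemma smooth_on_has_vector_derivative:
  fixes a :: "real \<Rightarrow> 'b::real_normed_vector"
  assumes "smooth_on W a" "x \<in> W"
  shows "(a has_vector_derivative vector_derivative a (at x)) (at x)"
  using smooth_on_imp_differentiable[OF assms] vector_derivative_works by blast

lemma smooth_on_vector_derivative:
  fixes a :: "real \<Rightarrow> 'b::real_normed_vector"
  assumes "open W" "smooth_on W a"
  shows "smooth_on W (\<lambda>x. vector_derivative a (at x))"
proof -
  have "frechet_derivative a (at x) 1 = vector_derivative a (at x)" if "x \<in> W" for x
    using frechet_derivative_eq_vector_derivative[OF smooth_on_imp_differentiable[OF assms(2) that]] by simp
  from smooth_on_cong[OF assms(1) this] show ?thesis
    using smooth_on_frechet_derivative[OF assms(2), of 1] by simp
qed

lemma smooth_on_compose: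
  fixes f :: "'a::real_normed_vector \<Rightarrow> 'b::euclidean_space"
  assumes "open S" "f ` S \<subseteq> T" "smooth_on S f" "smooth_on T g"
  shows "smooth_on S (\<lambda>x. g (f x))"
  using assms Ck_on_compose unfolding smooth_on_def by blast

lemma smooth_on_inverse:
  fixes f :: "'a::real_normed_vector \<Rightarrow> real"
  assumes "open S" "\<And>x. x \<in> S \<Longrightarrow> f x \<noteq> 0" "smooth_on S f"
  shows "smooth_on S (\<lambda>x. inverse (f x))"
  using assms Ck_on_inverse unfolding smooth_on_def by blast

text \<open>The solution \<open>t\<close> of an autonomous equation \<open>t' = w(t)\<close> inherits the regularity of the
  right-hand side: every derivative of \<open>f \<circ> t\<close> is again of the form \<open>f\<^sub>1 \<circ> t\<close>.\<close>

lemma smooth_on_compose_flow: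
  fixes f :: "real \<Rightarrow> 'b::real_normed_vector" and t w :: "real \<Rightarrow> real"
  assumes "open J" "open S" "t ` J \<subseteq> S" "smooth_on S w" "smooth_on S f"
    and t: "\<And>x. x \<in> J \<Longrightarrow> (t has_real_derivative w (t x)) (at x)"
  shows "smooth_on J (\<lambda>x. f (t x))"
proof -
  have "Ck_on n J (\<lambda>x. f (t x))" if "smooth_on S f" for n
    using that
  proof (induction n arbitrary: f)
    case 0
    have "continuous_on J t"
      using t by (meson DERIV_isCont continuous_at_imp_continuous_on)
    moreover have "continuous_on S f"
      using 0 unfolding smooth_on_def by (metis Ck_on.simps(1))
    ultimately show ?case using assms(3) by (auto intro: continuous_on_compose2)
  next
    case (Suc n)
    have sm: "smooth_on S (\<lambda>x. (v * w x) *\<^sub>R frechet_derivative f (at x) 1)" for v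
      using Suc.prems assms(2,4) smooth_on_frechet_derivative[OF Suc.prems]
      unfolding smooth_on_def by (auto intro!: Ck_on_scaleR Ck_on_mult Ck_on_const)
    have "((\<lambda>x. f (t x)) has_derivative (\<lambda>v. (v * w (t x)) *\<^sub>R frechet_derivative f (at (t x)) 1)) (at x)"
      if "x \<in> J" for x
    proof -
      have f: "(f has_derivative frechet_derivative f (at (t x))) (at (t x))"
        using smooth_on_imp_has_derivative[OF Suc.prems] that assms(3) by blast
      have "(t has_derivative (\<lambda>v. v * w (t x))) (at x)"
        using t[OF that] by (simp add: has_field_derivative_def mult_commute_abs)
      then have "(f \<circ> t has_derivative frechet_derivative f (at (t x)) \<circ> (\<lambda>v. v * w (t x))) (at x)"
        using f by (rule diff_chain_at)
      moreover have "frechet_derivative f (at (t x)) \<circ> (\<lambda>v. v * w (t x)) =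
          (\<lambda>v. (v * w (t x)) *\<^sub>R frechet_derivative f (at (t x)) 1)"
      proof
        show "(frechet_derivative f (at (t x)) \<circ> (\<lambda>v. v * w (t x))) v =
          (v * w (t x)) *\<^sub>R frechet_derivative f (at (t x)) 1" for v
          using linear_scale[OF has_derivative_linear[OF f], of "v * w (t x)" 1] by simp
      qed
      ultimately show ?thesis
        unfolding o_def by metis
    qed
    then show ?case
      by (rule Ck_on_SucI[OF assms(1) _ Suc.IH[OF sm]])
  qed
  with assms(5) show ?thesis by (simp add: smooth_on_def)
qed

text \<open>The one-dimensional inverse function theorem in the global form needed for a parameter
  change of positive speed: monotonicity gives injectivity, connectedness gives an interval as
  image, and invariance of domain gives openness.\<close>

lemma increasing_reparam:
  fixes s w :: "real \<Rightarrow> real"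
  assumes I: "open I" "is_interval I"
    and s: "\<forall>\<tau>\<in>I. (s has_real_derivative w \<tau>) (at \<tau>)" and w: "\<forall>\<tau>\<in>I. w \<tau> > 0"
  shows "continuous_on I s" "inj_on s I" "is_interval (s ` I)"
    and "W \<subseteq> I \<Longrightarrow> open W \<Longrightarrow> open (s ` W)"
    and "\<tau> \<in> I \<Longrightarrow> (inv_into I s has_real_derivative 1 / w \<tau>) (at (s \<tau>))"
proof -
  show cont: "continuous_on I s"
    using s by (meson DERIV_isCont continuous_at_imp_continuous_on)
  have "s x < s y" if "x \<in> I" "y \<in> I" "x < y" for x y
  proof (rule DERIV_pos_imp_increasing[OF \<open>x < y\<close>])
    fix z assume "x \<le> z" "z \<le> y"
    then have "z \<in> I" using I(2) that mem_is_interval_1_I by blast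
    then show "\<exists>d. (s has_real_derivative d) (at z) \<and> d > 0" using s w by blast
  qed
  then show inj: "inj_on s I"
    by (metis inj_onI linorder_neq_iff)
  show "is_interval (s ` I)"
    using connected_continuous_image[OF cont] I(2) by (simp add: is_interval_connected_1)
  show "open (s ` W)" if "W \<subseteq> I" "open W"
    using that cont inj by (meson continuous_on_subset inj_on_subset invariance_of_domain)
  show "(inv_into I s has_real_derivative 1 / w \<tau>) (at (s \<tau>))" if "\<tau> \<in> I"
    unfolding has_field_derivative_def
  proof (rule has_derivative_inverse_strong[OF I(1) that cont])
    show "(s has_derivative (*) (w \<tau>)) (at \<tau>)"
      using s that by (simp add: has_field_derivative_def)
    show "(*) (w \<tau>) \<circ> (*) (1 / w \<tau>) = id"
      using w that by (force simp: fun_eq_iff)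
  qed (simp add: inj)
qed

section \<open>Tangent spaces and symmetric forms on them\<close>

lemma smooth_atlasD:
  assumes "smooth_atlas A" "c \<in> A"
  shows "is_chart c" "d \<in> A \<Longrightarrow> smooth_on (snd c ` (fst c \<inter> fst d)) (snd d \<circ> chart_inv c)"
  using assms unfolding smooth_atlas_def by auto

lemma chart_inv_apply: "is_chart c \<Longrightarrow> p \<in> fst c \<Longrightarrow> chart_inv c (snd c p) = p"
  unfolding is_chart_def homeomorphism_def by auto

text \<open>A chart only preserves relative openness; since its domain and its image are both open,
  this is openness in the ambient spaces.\<close>

lemma chart_image_open:
  assumes "is_chart c" "open W"
  shows "open (snd c ` (fst c \<inter> W))"
proof -
  have "openin (top_of_set (fst c)) (fst c \<inter> W)"
    using assms(2) by auto
  then have "openin (top_of_set (snd c ` fst c)) (snd c ` (fst c \<inter> W))"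
    using assms(1) homeomorphism_imp_open_map unfolding is_chart_def by blast
  then show ?thesis
    using assms(1) openin_open_trans unfolding is_chart_def by blast
qed

lemma charts_atD:
  assumes "smooth_atlas A" "c \<in> charts_at A p"
  shows "c \<in> A" "p \<in> fst c" "is_chart c" "chart_inv c (snd c p) = p" "open (fst c)" "open (snd c ` fst c)"
proof -
  show c: "c \<in> A" "p \<in> fst c"
    using assms(2) unfolding charts_at_def by auto
  show ch: "is_chart c"
    by (rule smooth_atlasD(1)[OF assms(1) c(1)])
  show "chart_inv c (snd c p) = p"
    by (rule chart_inv_apply[OF ch c(2)])
  show "open (fst c)" "open (snd c ` fst c)"
    using ch unfolding is_chart_def by auto
qed

lemma charts_at_nonempty: "smooth_atlas A \<Longrightarrow> \<exists>c. c \<in> charts_at A p"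
  unfolding smooth_atlas_def charts_at_def by blast

lemma coord_change_has_derivative:
  assumes A: "smooth_atlas A" and c: "c \<in> charts_at A p" and d: "d \<in> charts_at A p"
  shows "(snd d \<circ> chart_inv c has_derivative coord_change c d p) (at (snd c p))"
  unfolding coord_change_def
  using smooth_on_imp_has_derivative[OF smooth_atlasD(2)[OF A]] charts_atD[OF A c] charts_atD[OF A d]
  by auto

lemmas coord_change_linear = coord_change_has_derivative[THEN has_derivative_linear]

text \<open>Chain rule. The composite of two transition maps agrees with the direct one only where
  the domains of \<open>c\<close> and \<open>d\<close> overlap, but this is an open set around the
  point. The cocycle identity is what makes \<open>tangent_of_coord\<close> a tangent
  vector.\<close>

lemma coord_change_trans:
  assumes A: "smooth_atlas A" and c: "c \<in> charts_at A p" and d: "d \<in> charts_at A p" and e: "e \<in> charts_at A p"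
  shows "coord_change d e p (coord_change c d p w) = coord_change c e p w"
proof -
  let ?S = "snd c ` (fst c \<inter> fst d)"
  have dp: "(snd d \<circ> chart_inv c) (snd c p) = snd d p"
    using charts_atD[OF A c] by simp
  have "((snd e \<circ> chart_inv d) \<circ> (snd d \<circ> chart_inv c) has_derivative
        coord_change d e p \<circ> coord_change c d p) (at (snd c p))"
    by (rule diff_chain_at[OF coord_change_has_derivative[OF A c d]])
      (simp add: dp coord_change_has_derivative[OF A d e, simplified o_def] o_def charts_atD(4)[OF A c])
  then have "coord_change d e p \<circ> coord_change c d p
      = frechet_derivative ((snd e \<circ> chart_inv d) \<circ> (snd d \<circ> chart_inv c)) (at (snd c p))"
    by (rule frechet_derivative_at)
  also have "\<dots> = frechet_derivative (snd e \<circ> chart_inv c) (at (snd c p))"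
  proof (rule frechet_derivative_cong_open)
    show "open ?S" using chart_image_open charts_atD[OF A c] charts_atD[OF A d] by blast
  qed (use charts_atD[OF A c] charts_atD[OF A d] in \<open>auto simp: chart_inv_apply\<close>)
  finally show ?thesis
    unfolding coord_change_def[of c e] by (metis comp_apply)
qed

lemma tangent_of_coord_in_tangent_space:
  assumes "smooth_atlas A" "c \<in> charts_at A p"
  shows "tangent_of_coord A c p w \<in> tangent_space A p"
  using assms unfolding tangent_space_def tangent_of_coord_def
  by (auto simp: coord_change_trans)

lemma tangent_spaceD:
  assumes "v \<in> tangent_space A p"
  shows "c \<notin> charts_at A p \<Longrightarrow> v c = 0"
    and "c \<in> charts_at A p \<Longrightarrow> d \<in> charts_at A p \<Longrightarrow> v d = coord_change c d p (v c)"
  using assms unfolding tangent_space_def by blast+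

lemma tangent_spaceI:
  assumes "\<And>c. c \<notin> charts_at A p \<Longrightarrow> v c = 0"
    and "\<And>c d. c \<in> charts_at A p \<Longrightarrow> d \<in> charts_at A p \<Longrightarrow> v d = coord_change c d p (v c)"
  shows "v \<in> tangent_space A p"
  using assms unfolding tangent_space_def by blast

lemma tangent_eq_sum:
  assumes A: "smooth_atlas A" and c: "c \<in> charts_at A p" and v: "v \<in> tangent_space A p"
  shows "v = (\<lambda>d. \<Sum>i\<in>UNIV. (v c $ i) *\<^sub>R tangent_of_coord A c p (axis i 1) d)"
proof
  fix d
  show "v d = (\<Sum>i\<in>UNIV. (v c $ i) *\<^sub>R tangent_of_coord A c p (axis i 1) d)"
  proof (cases "d \<in> charts_at A p")
    case True
    note l = coord_change_linear[OF A c True]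
    have "v d = coord_change c d p (\<Sum>i\<in>UNIV. (v c $ i) *\<^sub>R axis i 1)"
      using tangent_spaceD(2)[OF v c True] by (simp add: basis_expansion scalar_mult_eq_scaleR[symmetric])
    also have "\<dots> = (\<Sum>i\<in>UNIV. (v c $ i) *\<^sub>R coord_change c d p (axis i 1))"
      by (simp add: linear_sum[OF l] linear_scale[OF l])
    finally show ?thesis using True by (simp add: tangent_of_coord_def)
  qed (use tangent_spaceD(1)[OF v] in \<open>simp add: tangent_of_coord_def\<close>)
qed

section \<open>Vector space operations and symmetric bilinear forms on a tangent space\<close>

lemma zero_in_tangent_space:
  assumes "smooth_atlas A"
  shows "(\<lambda>c. 0) \<in> tangent_space A p"
  using linear_0[OF coord_change_linear[OF assms]] by (auto simp: tangent_space_def)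

lemma tscale_in_tangent_space:
  assumes A: "smooth_atlas A" and v: "v \<in> tangent_space A p"
  shows "tscale a v \<in> tangent_space A p"
proof (rule tangent_spaceI)
  show "tscale a v d = coord_change c d p (tscale a v c)"
    if "c \<in> charts_at A p" "d \<in> charts_at A p" for c d
    unfolding tscale_def tangent_spaceD(2)[OF v that] linear_scale[OF coord_change_linear[OF A that]] ..
qed (simp add: tscale_def tangent_spaceD(1)[OF v])

lemma tadd_in_tangent_space:
  assumes A: "smooth_atlas A" and u: "u \<in> tangent_space A p" and v: "v \<in> tangent_space A p"
  shows "tadd u v \<in> tangent_space A p"
proof (rule tangent_spaceI)
  show "tadd u v d = coord_change c d p (tadd u v c)"
    if "c \<in> charts_at A p" "d \<in> charts_at A p" for c d
    unfolding tadd_def tangent_spaceD(2)[OF u that] tangent_spaceD(2)[OF v that]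
      linear_add[OF coord_change_linear[OF A that]] ..
qed (simp add: tadd_def tangent_spaceD(1)[OF u] tangent_spaceD(1)[OF v])

text \<open>The algebraic part of a metric at a single point. Signature is left out, so the notion
  is stable under constant factors, and \<open>g p\<close> and \<open>h p\<close> times it fall
  under the same lemmas; definiteness on a surface enters separately through
  \<open>induces_riemannian\<close>.\<close>

definition tangent_form :: "'m chart set \<Rightarrow> 'm \<Rightarrow> ('m tangent \<Rightarrow> 'm tangent \<Rightarrow> real) \<Rightarrow> bool" where
  "tangent_form A p b \<longleftrightarrow>
     (\<forall>u\<in>tangent_space A p. \<forall>v\<in>tangent_space A p. b u v = b v u)
     \<and> (\<forall>u\<in>tangent_space A p. \<forall>v\<in>tangent_space A p. \<forall>w\<in>tangent_space A p. \<forall>x y.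
          b (tadd (tscale x u) (tscale y v)) w = x * b u w + y * b v w)"

lemma lorentzian_tangent_form: "lorentzian_manifold A g \<Longrightarrow> tangent_form A p (g p)"
  unfolding lorentzian_manifold_def tangent_form_def by blast

lemma lorentzian_smooth_atlas: "lorentzian_manifold A g \<Longrightarrow> smooth_atlas A"
  unfolding lorentzian_manifold_def by blast

lemma tangent_form_scale: "tangent_form A p b \<Longrightarrow> tangent_form A p (\<lambda>u v. k * b u v)"
  unfolding tangent_form_def by (auto simp: algebra_simps)

lemma tangent_form_tscale:
  assumes b: "tangent_form A p b" and A: "smooth_atlas A"
    and u: "u \<in> tangent_space A p" and v: "v \<in> tangent_space A p"
  shows "b (tscale x u) (tscale y v) = x * y * b u v"
proof -
  have *: "b (tscale z w) t = z * b w t" if "w \<in> tangent_space A p" "t \<in> tangent_space A p" for z w t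
  proof -
    \<comment> \<open>Linearity is only available for two-term combinations; a vanishing second term
      isolates homogeneity.\<close>
    have "tadd (tscale z w) (tscale 0 w) = tscale z w" by (simp add: tadd_def tscale_def)
    with b that show ?thesis unfolding tangent_form_def by (metis add.right_neutral mult_zero_left)
  qed
  have "b (tscale x u) (tscale y v) = x * b u (tscale y v)"
    by (intro * tscale_in_tangent_space A u v)
  also have "b u (tscale y v) = b (tscale y v) u"
    using b u tscale_in_tangent_space[OF A v] unfolding tangent_form_def by blast
  also have "\<dots> = y * b v u" by (intro * u v)
  also have "b v u = b u v" using b u v unfolding tangent_form_def by blast
  finally show ?thesis by simp
qed

text \<open>Both claims are proved in one induction because linearity applies to a partial sum only
  once that sum is known to be tangent.\<close>

lemma tangent_form_sum_left:
  assumes b: "tangent_form A p b" and A: "smooth_atlas A"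
    and t: "\<And>i. i \<in> J \<Longrightarrow> t i \<in> tangent_space A p" and v: "v \<in> tangent_space A p" and "finite J"
  shows "(\<lambda>d. \<Sum>i\<in>J. w i *\<^sub>R t i d) \<in> tangent_space A p
     \<and> b (\<lambda>d. \<Sum>i\<in>J. w i *\<^sub>R t i d) v = (\<Sum>i\<in>J. w i * b (t i) v)"
  using assms(5,3)
proof (induction J)
  case empty
  have "b (tscale 0 v) (tscale 1 v) = 0"
    by (subst tangent_form_tscale[OF b A v v]) simp
  then show ?case using zero_in_tangent_space[OF A] by (simp add: tscale_def)
next
  case (insert i J)
  let ?s = "\<lambda>d. \<Sum>i\<in>J. w i *\<^sub>R t i d"
  have s: "?s \<in> tangent_space A p" "b ?s v = (\<Sum>i\<in>J. w i * b (t i) v)"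
    using insert by auto
  have eq: "(\<lambda>d. \<Sum>i\<in>insert i J. w i *\<^sub>R t i d) = tadd (tscale (w i) (t i)) (tscale 1 ?s)"
    using insert.hyps by (simp add: tadd_def tscale_def)
  have "t i \<in> tangent_space A p" by (simp add: insert.prems)
  moreover from this have "b (tadd (tscale (w i) (t i)) (tscale 1 ?s)) v = w i * b (t i) v + 1 * b ?s v"
    using b s v unfolding tangent_form_def by blast
  ultimately show ?case
    unfolding eq using insert.hyps s(2)
    by (auto intro!: tadd_in_tangent_space tscale_in_tangent_space A s(1))
qed

lemma tangent_form_coord:
  assumes b: "tangent_form A p b" and A: "smooth_atlas A" and c: "c \<in> charts_at A p"
    and u: "u \<in> tangent_space A p" and v: "v \<in> tangent_space A p"
  shows "b u v = (\<Sum>i\<in>UNIV. \<Sum>j\<in>UNIV. b (tangent_of_coord A c p (axis i 1)) (tangent_of_coord A c p (axis j 1))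
      * u c $ i * v c $ j)"
proof -
  let ?t = "\<lambda>i. tangent_of_coord A c p (axis i 1)"
  have t: "?t i \<in> tangent_space A p" for i
    by (rule tangent_of_coord_in_tangent_space[OF A c])
  have sym: "b x y = b y x" if "x \<in> tangent_space A p" "y \<in> tangent_space A p" for x y
    using b that unfolding tangent_form_def by blast
  have exp: "b x y = (\<Sum>i\<in>UNIV. x c $ i * b (?t i) y)"
    if x: "x \<in> tangent_space A p" and y: "y \<in> tangent_space A p" for x y
  proof -
    have "b x y = b (\<lambda>d. \<Sum>i\<in>UNIV. (x c $ i) *\<^sub>R ?t i d) y"
      using tangent_eq_sum[OF A c x] by simp
    also have "\<dots> = (\<Sum>i\<in>UNIV. x c $ i * b (?t i) y)"
      using tangent_form_sum_left[OF b A _ y, of UNIV ?t "\<lambda>i. x c $ i"] t by simp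
    finally show ?thesis .
  qed
  have "b u v = (\<Sum>i\<in>UNIV. u c $ i * b v (?t i))"
    using exp[OF u v] sym[OF t v] by simp
  also have "\<dots> = (\<Sum>i\<in>UNIV. u c $ i * (\<Sum>j\<in>UNIV. v c $ j * b (?t i) (?t j)))"
    using exp[OF v t] sym[OF t t] by simp
  finally show ?thesis
    by (simp add: sum_distrib_left mult_ac)
qed

section \<open>Components of a Lorentzian metric in a chart\<close>

lemma metric_coord_eq:
  assumes g: "lorentzian_manifold A g" and c: "c \<in> charts_at A p"
    and u: "u \<in> tangent_space A p" and v: "v \<in> tangent_space A p"
  shows "g p u v = (\<Sum>i\<in>UNIV. \<Sum>j\<in>UNIV. metric_coord A g c (snd c p) $ i $ j * u c $ i * v c $ j)"
  using tangent_form_coord[OF lorentzian_tangent_form[OF g] lorentzian_smooth_atlas[OF g] c u v]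
    charts_atD(4)[OF lorentzian_smooth_atlas[OF g] c]
  by (simp add: metric_coord_def)

text \<open>Let the rows of E be the components of an orthonormal frame. Then E G E^T is the
  diagonal matrix N of signs, and N squares to the identity, so taking determinants shows that det G
  is nonzero.\<close>

lemma metric_coord_invertible:
  assumes g: "lorentzian_manifold A g" and c: "c \<in> charts_at A p"
  shows "invertible (metric_coord A g c (snd c p))"
proof -
  let ?G = "metric_coord A g c (snd c p)"
  obtain e :: "4 \<Rightarrow> 'a tangent" where e: "\<And>i. e i \<in> tangent_space A p"
    "\<And>i j. g p (e i) (e j) = (if i \<noteq> j then 0 else if i = 0 then 1 else -1)"
    using g unfolding lorentzian_manifold_def by metis
  define E :: "real^4^4" where "E = (\<chi> i j. e i c $ j)"
  define s :: "4 \<Rightarrow> real" where "s i = (if i = 0 then 1 else -1)" for i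
  define N :: "real^4^4" where "N = (\<chi> i j. if i = j then s i else 0)"
  have "(E ** (?G ** transpose E)) $ k $ l = N $ k $ l" for k l
  proof -
    have "(E ** (?G ** transpose E)) $ k $ l = g p (e k) (e l)"
      unfolding metric_coord_eq[OF g c e(1) e(1)]
      by (simp add: matrix_matrix_mult_def transpose_def E_def sum_distrib_left mult_ac)
    then show ?thesis by (simp add: e(2) N_def s_def)
  qed
  then have "E ** (?G ** transpose E) = N"
    by (simp add: vec_eq_iff)
  moreover have "N ** N = mat 1"
  proof -
    have "(\<Sum>k\<in>UNIV. N $ i $ k * N $ k $ j) = mat 1 $ i $ j" for i j
    proof -
      have "(\<Sum>k\<in>UNIV. N $ i $ k * N $ k $ j) = (\<Sum>k\<in>UNIV. if k = i then s i * N $ i $ j else 0)"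
        by (rule sum.cong) (auto simp: N_def)
      also have "\<dots> = mat 1 $ i $ j"
        by (simp add: N_def mat_def s_def)
      finally show ?thesis .
    qed
    then show ?thesis by (simp add: vec_eq_iff matrix_matrix_mult_def)
  qed
  ultimately have "(det E * (det ?G * det (transpose E))) * det N = 1"
    by (metis det_mul det_I)
  then have "det ?G \<noteq> 0" by auto
  then show ?thesis by (simp add: invertible_det_nz)
qed

lemma metric_coord_conformal:
  "metric_coord A (conformal h g) c x = h (chart_inv c x) *\<^sub>R metric_coord A g c x"
  by (simp add: metric_coord_def conformal_def vec_eq_iff Let_def)

lemma metric_coord_sym:
  assumes g: "lorentzian_manifold A g" and c: "c \<in> charts_at A p"
  shows "metric_coord A g c (snd c p) $ i $ j = metric_coord A g c (snd c p) $ j $ i"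
  using lorentzian_tangent_form[OF g, of p] charts_atD(4)[OF lorentzian_smooth_atlas[OF g] c]
    tangent_of_coord_in_tangent_space[OF lorentzian_smooth_atlas[OF g] c]
  unfolding tangent_form_def by (simp add: metric_coord_def)

section \<open>Christoffel symbols under conformal changes\<close>

lemma matrix_inv_inverse:
  fixes M :: "real^'n^'n"
  assumes "invertible M"
  shows "M ** matrix_inv M = mat 1" "matrix_inv M ** M = mat 1"
  using assms unfolding invertible_def matrix_inv_def by (metis (mono_tags, lifting) someI_ex)+

lemma matrix_inv_eqI:
  fixes M :: "real^'n^'n"
  assumes "M ** B = mat 1" "B ** M = mat 1"
  shows "matrix_inv M = B"
proof -
  have "invertible M" using assms invertible_def by blast
  then have "matrix_inv M = matrix_inv M ** (M ** B)" by (simp add: assms)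
  also have "\<dots> = B"
    by (simp add: matrix_mul_assoc matrix_inv_inverse(2)[OF \<open>invertible M\<close>])
  finally show ?thesis .
qed

lemma matrix_inv_scaleR:
  fixes M :: "real^'n^'n"
  assumes "invertible M" "k \<noteq> 0"
  shows "matrix_inv (k *\<^sub>R M) = (1 / k) *\<^sub>R matrix_inv M"
  using assms by (intro matrix_inv_eqI) (simp_all add: matrix_scalar_ac scalar_matrix_assoc[symmetric] matrix_inv_inverse)

lemma pderiv_at_mult:
  assumes "f differentiable (at x)" "g differentiable (at x)"
  shows "pderiv_at i (\<lambda>y. f y * g y) x = f x * pderiv_at i g x + pderiv_at i f x * g x"
  using frechet_derivative_eqI[OF has_derivative_mult[OF assms[unfolded frechet_derivative_works]]]
  by (simp add: pderiv_at_def)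

text \<open>The factor 1/f from the inverse matrix cancels f wherever the product rule
  differentiates G, and the terms with derivatives of f form the correction. It is kept as a
  contraction with the inverse matrix because both uses need only that: null vectors in dimension 4,
  and a constant f, for which it vanishes, in dimension 2.\<close>

lemma christoffel_conformal:
  fixes G :: "real^'n::finite \<Rightarrow> real^'n^'n"
  assumes G: "\<And>i j. (\<lambda>y. G y $ i $ j) differentiable (at x)" and f: "f differentiable (at x)"
    and "f x \<noteq> 0" "invertible (G x)"
  shows "christoffel (\<lambda>y. f y *\<^sub>R G y) k i j x = christoffel G k i j x
    + (\<Sum>l\<in>UNIV. matrix_inv (G x) $ k $ l * (pderiv_at i f x * G x $ j $ l + pderiv_at j f x * G x $ i $ l
         - pderiv_at l f x * G x $ i $ j)) / (2 * f x)"
proof -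
  have "christoffel (\<lambda>y. f y *\<^sub>R G y) k i j x = (\<Sum>l\<in>UNIV.
     matrix_inv (G x) $ k $ l *
     (pderiv_at i (\<lambda>y. G y $ j $ l) x + pderiv_at j (\<lambda>y. G y $ i $ l) x
       - pderiv_at l (\<lambda>y. G y $ i $ j) x)
     + matrix_inv (G x) $ k $ l * (pderiv_at i f x * G x $ j $ l + pderiv_at j f x * G x $ i $ l
         - pderiv_at l f x * G x $ i $ j) / f x) / 2"
    using assms unfolding christoffel_def
    by (simp add: matrix_inv_scaleR pderiv_at_mult field_simps)
  then show ?thesis
    by (simp add: christoffel_def sum.distrib add_divide_distrib sum_divide_distrib mult.commute[of 2])
qed

text \<open>Let D be the derivative of f along \<open>v\<close>. By symmetry of G, each of the first
  two correction terms contributes D (G v)_l, so their sum cancels the 2 in the denominator, and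
  \<open>matrix_inv (G x)\<close> turns G v back into v. The third term contains the vanishing
  square of \<open>v\<close>.\<close>

lemma christoffel_conformal_null:
  fixes G :: "real^'n::finite \<Rightarrow> real^'n^'n"
  assumes G: "\<And>i j. (\<lambda>y. G y $ i $ j) differentiable (at x)" and f: "f differentiable (at x)"
    and fx: "f x \<noteq> 0" and inv: "invertible (G x)" and sym: "\<And>i j. G x $ i $ j = G x $ j $ i"
    and null: "(\<Sum>i\<in>UNIV. \<Sum>j\<in>UNIV. G x $ i $ j * v $ i * v $ j) = 0"
  shows "(\<Sum>i\<in>UNIV. \<Sum>j\<in>UNIV. christoffel (\<lambda>y. f y *\<^sub>R G y) k i j x * v $ i * v $ j)
    = (\<Sum>i\<in>UNIV. \<Sum>j\<in>UNIV. christoffel G k i j x * v $ i * v $ j)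
      + (\<Sum>i\<in>UNIV. pderiv_at i f x * v $ i) / f x * v $ k"
proof -
  let ?M = "matrix_inv (G x)"
  let ?D = "\<Sum>i\<in>UNIV. pderiv_at i f x * v $ i"
  have inner: "(\<Sum>i\<in>UNIV. \<Sum>j\<in>UNIV. (pderiv_at i f x * G x $ j $ l + pderiv_at j f x * G x $ i $ l
         - pderiv_at l f x * G x $ i $ j) * v $ i * v $ j) = 2 * ?D * (G x *v v) $ l" for l
  proof -
    have a: "(\<Sum>i\<in>UNIV. \<Sum>j\<in>UNIV. pderiv_at i f x * G x $ j $ l * v $ i * v $ j) = ?D * (G x *v v) $ l"
      by (simp add: matrix_vector_mult_def sum_product sym[of _ l] mult_ac)
    have b: "(\<Sum>i\<in>UNIV. \<Sum>j\<in>UNIV. pderiv_at j f x * G x $ i $ l * v $ i * v $ j) = ?D * (G x *v v) $ l"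
      by (subst sum.swap) (simp add: matrix_vector_mult_def sum_product sym[of _ l] mult_ac)
    have c: "(\<Sum>i\<in>UNIV. \<Sum>j\<in>UNIV. pderiv_at l f x * G x $ i $ j * v $ i * v $ j) = 0"
      using null by (simp add: sum_distrib_left[symmetric] mult.assoc)
    show ?thesis
      using a b c by (simp add: algebra_simps sum.distrib sum_subtractf)
  qed
  have "(\<Sum>i\<in>UNIV. \<Sum>j\<in>UNIV. (\<Sum>l\<in>UNIV. ?M $ k $ l * (pderiv_at i f x * G x $ j $ l + pderiv_at j f x * G x $ i $ l
         - pderiv_at l f x * G x $ i $ j)) * v $ i * v $ j)
    = (\<Sum>i\<in>UNIV. \<Sum>j\<in>UNIV. \<Sum>l\<in>UNIV. ?M $ k $ l * ((pderiv_at i f x * G x $ j $ l + pderiv_at j f x * G x $ i $ l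
         - pderiv_at l f x * G x $ i $ j) * v $ i * v $ j))"
    by (simp add: sum_distrib_right mult.assoc)
  also have "\<dots> = (\<Sum>l\<in>UNIV. \<Sum>i\<in>UNIV. \<Sum>j\<in>UNIV. ?M $ k $ l * ((pderiv_at i f x * G x $ j $ l + pderiv_at j f x * G x $ i $ l
         - pderiv_at l f x * G x $ i $ j) * v $ i * v $ j))"
    by (subst (2) sum.swap, subst sum.swap, rule refl)
  also have "\<dots> = (\<Sum>l\<in>UNIV. ?M $ k $ l * (2 * ?D * (G x *v v) $ l))"
    by (simp only: sum_distrib_left[symmetric] inner)
  also have "\<dots> = 2 * ?D * (?M *v (G x *v v)) $ k"
    by (simp add: matrix_vector_mult_def[of ?M] sum_distrib_left mult_ac)
  also have "?M *v (G x *v v) = v"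
    by (simp add: matrix_vector_mul_assoc matrix_inv_inverse(2)[OF inv])
  finally have corr: "(\<Sum>i\<in>UNIV. \<Sum>j\<in>UNIV. (\<Sum>l\<in>UNIV. ?M $ k $ l * (pderiv_at i f x * G x $ j $ l + pderiv_at j f x * G x $ i $ l
         - pderiv_at l f x * G x $ i $ j)) * v $ i * v $ j) = 2 * ?D * v $ k" .
  have "(\<Sum>i\<in>UNIV. \<Sum>j\<in>UNIV. christoffel (\<lambda>y. f y *\<^sub>R G y) k i j x * v $ i * v $ j)
     = (\<Sum>i\<in>UNIV. \<Sum>j\<in>UNIV. christoffel G k i j x * v $ i * v $ j +
       ((\<Sum>l\<in>UNIV. ?M $ k $ l * (pderiv_at i f x * G x $ j $ l + pderiv_at j f x * G x $ i $ l
         - pderiv_at l f x * G x $ i $ j)) * v $ i * v $ j) / (2 * f x))"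
    by (simp add: christoffel_conformal[OF G f fx inv] ring_distribs)
  also have "\<dots> = (\<Sum>i\<in>UNIV. \<Sum>j\<in>UNIV. christoffel G k i j x * v $ i * v $ j) + 2 * ?D * v $ k / (2 * f x)"
    by (simp only: sum.distrib sum_divide_distrib[symmetric] corr)
  finally show ?thesis using fx by simp
qed

section \<open>Conformal reparametrization of null geodesics\<close>

lemma has_vector_derivative_coord:
  fixes f :: "real^4 \<Rightarrow> real"
  assumes a: "(a has_vector_derivative v) (at \<tau>)" and f: "f differentiable (at (a \<tau>))"
  shows "((\<lambda>t. f (a t)) has_real_derivative (\<Sum>i\<in>UNIV. pderiv_at i f (a \<tau>) * v $ i)) (at \<tau>)"
proof -
  let ?F = "frechet_derivative f (at (a \<tau>))"
  have F: "(f has_derivative ?F) (at (a \<tau>))"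
    using f frechet_derivative_works by blast
  note l = has_derivative_linear[OF F]
  have "?F v = ?F (\<Sum>i\<in>UNIV. v $ i *\<^sub>R axis i 1)"
    by (simp add: basis_expansion scalar_mult_eq_scaleR[symmetric])
  also have "\<dots> = (\<Sum>i\<in>UNIV. pderiv_at i f (a \<tau>) * v $ i)"
    by (simp add: linear_sum[OF l] linear_scale[OF l] pderiv_at_def mult.commute)
  finally have Fv: "?F v = (\<Sum>i\<in>UNIV. pderiv_at i f (a \<tau>) * v $ i)" .
  have "(f \<circ> a has_derivative ?F \<circ> (\<lambda>x. x *\<^sub>R v)) (at \<tau>)"
    using diff_chain_at[OF a[unfolded has_vector_derivative_def] F] .
  moreover have "?F \<circ> (\<lambda>x. x *\<^sub>R v) = (*) (\<Sum>i\<in>UNIV. pderiv_at i f (a \<tau>) * v $ i)"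
    by (auto simp: fun_eq_iff linear_scale[OF l] Fv)
  ultimately show ?thesis
    by (simp add: has_field_derivative_def o_def)
qed

lemma smooth_fun_coord:
  assumes "smooth_atlas A" "smooth_fun A h" "c \<in> charts_at A p"
  shows "smooth_on (snd c ` fst c) (\<lambda>x. h (chart_inv c x))"
  using assms charts_atD(1)[OF assms(1,3)] unfolding smooth_fun_def o_def by blast

lemma conformal_reparam_exists:
  assumes I: "open I" "is_interval I" and cont: "continuous_on I (\<lambda>\<tau>. h (\<gamma> \<tau>))"
    and pos: "\<forall>p. h p > 0"
  shows "\<exists>s \<gamma>' I'. conformal_reparam h s (\<gamma>, I) (\<gamma>', I')"
proof -
  have "\<exists>s. \<forall>\<tau>\<in>I. (s has_real_derivative h (\<gamma> \<tau>)) (at \<tau>)"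
  proof (cases "I = {}")
    case False
    \<comment> \<open>The parameter interval may be unbounded. Extended real endpoints bring it into
      the form \<open>einterval a b\<close>, on which a continuous function has a global
      antiderivative; openness of I keeps the endpoints outside.\<close>
    define a b where "a = Inf (ereal ` I)" and "b = Sup (ereal ` I)"
    have x: "x \<in> I \<longleftrightarrow> a < ereal x \<and> ereal x < b" for x
    proof
      assume "x \<in> I"
      then obtain e where "e > 0" "ball x e \<subseteq> I"
        using I(1) open_contains_ball by blast
      then have "x - e / 2 \<in> I \<and> x - e / 2 < x" "x + e / 2 \<in> I \<and> x < x + e / 2"
        by (auto simp: subset_iff dist_real_def)
      then have "\<exists>y\<in>I. y < x" "\<exists>y\<in>I. x < y" by blast+
      then show "a < ereal x \<and> ereal x < b"
        by (auto simp: a_def b_def Inf_less_iff less_Sup_iff)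
    next
      assume "a < ereal x \<and> ereal x < b"
      then obtain y z where "y \<in> I" "z \<in> I" "y < x" "x < z"
        unfolding a_def b_def Inf_less_iff less_Sup_iff by auto
      then show "x \<in> I" using I(2) unfolding is_interval_1 by (meson less_imp_le)
    qed
    then have ab: "a < b" "I = einterval a b"
      using False by (auto simp: einterval_iff intro: less_trans)
    have "isCont (\<lambda>\<tau>. h (\<gamma> \<tau>)) x" if "x \<in> I" for x
      using cont I(1) that continuous_on_eq_continuous_at by blast
    then obtain F where "\<forall>x. a < ereal x \<longrightarrow> x < b \<longrightarrow> (F has_vector_derivative h (\<gamma> x)) (at x)"
      using einterval_antiderivative[OF ab(1), of "\<lambda>x. h (\<gamma> x)"] ab(2) by (auto simp: einterval_iff)
    then show ?thesis
      using x unfolding has_real_derivative_iff_has_vector_derivative by blast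
  qed simp
  then obtain s where s: "\<forall>\<tau>\<in>I. (s has_real_derivative h (\<gamma> \<tau>)) (at \<tau>)" ..
  have inj: "inj_on s I"
    by (rule increasing_reparam(2)[OF I]) (use s pos in auto)
  have "conformal_reparam h s (\<gamma>, I) (restrict (\<gamma> \<circ> inv_into I s) (s ` I), s ` I)"
    using s inj by (simp add: conformal_reparam_def)
  then show ?thesis by blast
qed

lemma smooth_curveD:
  assumes "smooth_curve A (\<gamma>, I)"
  shows "I \<noteq> {}" "open I" "is_interval I" "\<gamma> \<in> extensional I" "continuous_on I \<gamma>"
    "c \<in> A \<Longrightarrow> smooth_on {\<tau>\<in>I. \<gamma> \<tau> \<in> fst c} (snd c \<circ> \<gamma>)"
  using assms unfolding smooth_curve_def by auto

text \<open>Smoothness of \<open>h\<close> is given in charts only, so continuity along the curve is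
  checked near each parameter, where the curve stays in one chart.\<close>

lemma smooth_fun_continuous_on_curve:
  assumes A: "smooth_atlas A" and h: "smooth_fun A h" and \<gamma>: "smooth_curve A (\<gamma>, I)"
  shows "continuous_on I (\<lambda>\<tau>. h (\<gamma> \<tau>))"
proof -
  have "isCont (\<lambda>\<tau>. h (\<gamma> \<tau>)) \<tau>" if "\<tau> \<in> I" for \<tau>
  proof -
    obtain c where c: "c \<in> charts_at A (\<gamma> \<tau>)" using charts_at_nonempty[OF A] by blast
    define W where "W = {\<tau>\<in>I. \<gamma> \<tau> \<in> fst c}"
    have "open W"
      using continuous_open_preimage[OF smooth_curveD(5,2)[OF \<gamma>] charts_atD(5)[OF A c]]
      by (simp add: W_def vimage_def Int_def)
    have tW: "\<tau> \<in> W" using that charts_atD(2)[OF A c] by (simp add: W_def)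
    have 1: "continuous_on W (snd c \<circ> \<gamma>)"
      using smooth_curveD(6)[OF \<gamma> charts_atD(1)[OF A c]] unfolding W_def[symmetric] smooth_on_def
      by (metis Ck_on.simps(1))
    have 2: "continuous_on (snd c ` fst c) (\<lambda>x. h (chart_inv c x))"
      using smooth_fun_coord[OF A h c] unfolding smooth_on_def by (metis Ck_on.simps(1))
    have "continuous_on W (\<lambda>\<tau>. h (chart_inv c ((snd c \<circ> \<gamma>) \<tau>)))"
      by (rule continuous_on_compose2[OF 2 1]) (auto simp: W_def)
    then have "continuous_on W (\<lambda>\<tau>. h (\<gamma> \<tau>))"
      by (rule continuous_on_eq) (simp add: W_def chart_inv_apply[OF charts_atD(3)[OF A c]])
    then show ?thesis
      using \<open>open W\<close> tW continuous_on_eq_continuous_at by blast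
  qed
  then show ?thesis by (simp add: continuous_at_imp_continuous_on)
qed

lemma geodesicD:
  assumes "geodesic A g (\<gamma>, I)"
  shows "smooth_curve A (\<gamma>, I)"
    "\<tau> \<in> I \<Longrightarrow> c \<in> charts_at A (\<gamma> \<tau>) \<Longrightarrow>
          vector_derivative (\<lambda>t. vector_derivative (snd c \<circ> \<gamma>) (at t)) (at \<tau>) $ k
          + (\<Sum>i\<in>UNIV. \<Sum>j\<in>UNIV. christoffel (metric_coord A g c) k i j (snd c (\<gamma> \<tau>))
               * velocity A \<gamma> \<tau> c $ i * velocity A \<gamma> \<tau> c $ j) = 0"
  using assms unfolding geodesic_def by auto

text \<open>All analysis takes place in one chart, on the set \<open>W\<close> of parameters at
  which the curve lies in its domain. With a the coordinate curve, f the coordinate form of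
  \<open>h\<close> and t the inverse of \<open>s\<close>, the new coordinate curve is a composed
  with t.\<close>

lemma conformal_reparam_chart:
  assumes g: "lorentzian_manifold A g" and h: "smooth_fun A h" and pos: "\<forall>p. h p > 0"
    and \<gamma>: "null_geodesic A g (\<gamma>, I)" and rep: "conformal_reparam h s (\<gamma>, I) (\<gamma>', I')"
    and c: "c \<in> A"
  defines "W \<equiv> {\<tau>\<in>I. \<gamma> \<tau> \<in> fst c}"
  shows "{\<sigma>\<in>I'. \<gamma>' \<sigma> \<in> fst c} = s ` W" "open (s ` W)" "smooth_on (s ` W) (snd c \<circ> \<gamma>')"
    and "\<tau> \<in> W \<Longrightarrow> vector_derivative (snd c \<circ> \<gamma>') (at (s \<tau>))
        = (1 / h (\<gamma> \<tau>)) *\<^sub>R vector_derivative (snd c \<circ> \<gamma>) (at \<tau>)"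
    and "\<tau> \<in> W \<Longrightarrow> vector_derivative (\<lambda>t. vector_derivative (snd c \<circ> \<gamma>') (at t)) (at (s \<tau>)) $ k
          + (\<Sum>i\<in>UNIV. \<Sum>j\<in>UNIV. christoffel (metric_coord A (conformal h g) c) k i j (snd c (\<gamma> \<tau>))
               * vector_derivative (snd c \<circ> \<gamma>') (at (s \<tau>)) $ i
               * vector_derivative (snd c \<circ> \<gamma>') (at (s \<tau>)) $ j) = 0"
proof -
  note A = lorentzian_smooth_atlas[OF g]
  have geo: "geodesic A g (\<gamma>, I)" and null: "\<And>\<tau>. \<tau> \<in> I \<Longrightarrow> velocity A \<gamma> \<tau> \<in> light_cone A g (\<gamma> \<tau>)"
    using \<gamma> unfolding null_geodesic_def by auto
  note sm = geodesicD(1)[OF geo]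
  note I = smooth_curveD(2,3)[OF sm]
  have s: "\<forall>\<tau>\<in>I. (s has_real_derivative h (\<gamma> \<tau>)) (at \<tau>)"
    and I': "I' = s ` I" and \<gamma>': "\<And>\<tau>. \<tau> \<in> I \<Longrightarrow> \<gamma>' (s \<tau>) = \<gamma> \<tau>"
    using rep unfolding conformal_reparam_def by auto
  have hpos: "\<forall>\<tau>\<in>I. h (\<gamma> \<tau>) > 0" using pos by blast
  note R = increasing_reparam[OF I s hpos]
  define t where "t = inv_into I s"
  have ts: "\<And>\<tau>. \<tau> \<in> I \<Longrightarrow> t (s \<tau>) = \<tau>" using R(2) by (simp add: t_def)
  show img: "{\<sigma>\<in>I'. \<gamma>' \<sigma> \<in> fst c} = s ` W"
    using \<gamma>' by (auto simp: I' W_def)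
  have ch: "is_chart c" by (rule smooth_atlasD(1)[OF A c])
  then have "open (fst c)" unfolding is_chart_def by blast
  then have W: "open W" "W \<subseteq> I"
    using continuous_open_preimage[OF smooth_curveD(5,2)[OF sm]]
    by (auto simp add: W_def vimage_def Int_def)
  have cat: "c \<in> charts_at A (\<gamma> \<tau>)" if "\<tau> \<in> W" for \<tau> using that c by (simp add: charts_at_def W_def)
  show oJ: "open (s ` W)" by (rule R(4)[OF W(2,1)])
  define a where "a = snd c \<circ> \<gamma>"
  have a: "smooth_on W a" using smooth_curveD(6)[OF sm c] by (simp add: a_def W_def)
  define f where "f = (\<lambda>x. h (chart_inv c x))"
  have f: "smooth_on (snd c ` fst c) f"
    using h c unfolding smooth_fun_def f_def o_def by blast
  have fa: "f (a \<tau>) = h (\<gamma> \<tau>)" if "\<tau> \<in> W" for \<tau>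
    using that chart_inv_apply[OF ch] by (simp add: f_def a_def W_def)
  have aW: "a ` W \<subseteq> snd c ` fst c" by (auto simp: a_def W_def)
  \<comment> \<open>Of \<open>s\<close> only the first derivative is given. Its inverse solves t' =
    w(t) with this smooth w, so \<open>smooth_on_compose_flow\<close> supplies the higher
    regularity.\<close>
  have w: "smooth_on W (\<lambda>\<tau>. inverse (f (a \<tau>)))"
    by (intro smooth_on_inverse smooth_on_compose[OF W(1) aW a f] W(1)) (use fa hpos W(2) in force)
  have td: "(t has_real_derivative inverse (f (a \<tau>))) (at (s \<tau>))" if "\<tau> \<in> W" for \<tau>
    using R(5)[of \<tau>] W(2) that by (auto simp: t_def fa inverse_eq_divide)
  have flow: "smooth_on (s ` W) (\<lambda>\<sigma>. a (t \<sigma>))"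
    by (rule smooth_on_compose_flow[OF oJ W(1) _ w a]) (use ts W(2) td in auto)
  have eq: "(snd c \<circ> \<gamma>') \<sigma> = a (t \<sigma>)" if "\<sigma> \<in> s ` W" for \<sigma>
    using that ts \<gamma>' W(2) by (auto simp: a_def)
  show "smooth_on (s ` W) (snd c \<circ> \<gamma>')"
    by (subst smooth_on_cong[OF oJ eq]) (simp_all only: flow)
  let ?a' = "\<lambda>\<tau>. vector_derivative a (at \<tau>)"
  have tv: "(t has_vector_derivative inverse (f (a \<tau>))) (at (s \<tau>))" if "\<tau> \<in> W" for \<tau>
    using td[OF that] by (simp add: has_real_derivative_iff_has_vector_derivative)
  \<comment> \<open>Used twice: with the coordinate curve for the velocity, and with the rescaled
    velocity for the acceleration.\<close>
  have chain: "((\<lambda>\<sigma>. b (t \<sigma>)) has_vector_derivative inverse (f (a \<tau>)) *\<^sub>R b') (at (s \<tau>))"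
    if "\<tau> \<in> W" "(b has_vector_derivative b') (at \<tau>)" for b b' \<tau>
    using vector_diff_chain_at[OF tv[OF that(1)], of b b'] that ts W(2) by (auto simp: o_def)
  have vel: "vector_derivative (snd c \<circ> \<gamma>') (at (s \<tau>)) = inverse (f (a \<tau>)) *\<^sub>R ?a' \<tau>" if "\<tau> \<in> W" for \<tau>
  proof (rule vector_derivative_at)
    show "(snd c \<circ> \<gamma>' has_vector_derivative inverse (f (a \<tau>)) *\<^sub>R ?a' \<tau>) (at (s \<tau>))"
      by (rule has_vector_derivative_transform_within_open
          [OF chain[OF that smooth_on_has_vector_derivative[OF a that]] oJ imageI[OF that]]) (simp only: eq)
  qed
  show "vector_derivative (snd c \<circ> \<gamma>') (at (s \<tau>))
        = (1 / h (\<gamma> \<tau>)) *\<^sub>R vector_derivative (snd c \<circ> \<gamma>) (at \<tau>)" if "\<tau> \<in> W"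
    using vel[OF that] fa[OF that] by (simp add: a_def inverse_eq_divide)
  show "vector_derivative (\<lambda>t. vector_derivative (snd c \<circ> \<gamma>') (at t)) (at (s \<tau>)) $ k
          + (\<Sum>i\<in>UNIV. \<Sum>j\<in>UNIV. christoffel (metric_coord A (conformal h g) c) k i j (snd c (\<gamma> \<tau>))
               * vector_derivative (snd c \<circ> \<gamma>') (at (s \<tau>)) $ i
               * vector_derivative (snd c \<circ> \<gamma>') (at (s \<tau>)) $ j) = 0" if \<tau>: "\<tau> \<in> W"
  proof -
    let ?v = "?a' \<tau>" and ?x = "a \<tau>"
    let ?a'' = "vector_derivative ?a' (at \<tau>)"
    let ?G = "metric_coord A g c"
    let ?D = "\<Sum>i\<in>UNIV. pderiv_at i f ?x * ?v $ i"
    let ?H = "f ?x"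
    have x: "?x \<in> snd c ` fst c" using aW \<tau> by blast
    have fx: "?H > 0" using fa[OF \<tau>] hpos \<tau> W(2) by auto
    have fd: "f differentiable (at ?x)" by (rule smooth_on_imp_differentiable[OF f x])
    have "((\<lambda>t. f (a t)) has_real_derivative ?D) (at \<tau>)"
      by (rule has_vector_derivative_coord[OF smooth_on_has_vector_derivative[OF a \<tau>] fd])
    then have "((\<lambda>t. inverse (f (a t))) has_real_derivative - (inverse ?H * ?D * inverse ?H)) (at \<tau>)"
      using fx by (intro DERIV_inverse') auto
    then have "((\<lambda>t. inverse (f (a t)) *\<^sub>R ?a' t) has_vector_derivative
        inverse ?H *\<^sub>R ?a'' + (- (inverse ?H * ?D * inverse ?H)) *\<^sub>R ?v) (at \<tau>)"
      by (rule has_vector_derivative_scaleR)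
        (rule smooth_on_has_vector_derivative[OF smooth_on_vector_derivative[OF W(1) a] \<tau>])
    \<comment> \<open>At the old parameter the new velocity is a'/H. Its derivative picks up another
      1/H from the change of parameter, so the new acceleration is a''/H^2 - (D/H^3) a'.\<close>
    note chain[OF \<tau> this]
    then have "((\<lambda>t. vector_derivative (snd c \<circ> \<gamma>') (at t)) has_vector_derivative
       inverse ?H *\<^sub>R (inverse ?H *\<^sub>R ?a'' + (- (inverse ?H * ?D * inverse ?H)) *\<^sub>R ?v)) (at (s \<tau>))"
      by (rule has_vector_derivative_transform_within_open[OF _ oJ imageI[OF \<tau>]])
        (use vel ts W(2) in auto)
    then have acc: "vector_derivative (\<lambda>t. vector_derivative (snd c \<circ> \<gamma>') (at t)) (at (s \<tau>)) =
       inverse ?H *\<^sub>R (inverse ?H *\<^sub>R ?a'' + (- (inverse ?H * ?D * inverse ?H)) *\<^sub>R ?v)"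
      by (rule vector_derivative_at)
    have velA: "velocity A \<gamma> \<tau> c = ?v" using cat[OF \<tau>] by (simp add: velocity_def a_def)
    have \<tau>I: "\<tau> \<in> I" using \<tau> W(2) by blast
    have xg: "snd c (\<gamma> \<tau>) = ?x" by (simp add: a_def)
    have nullv: "(\<Sum>i\<in>UNIV. \<Sum>j\<in>UNIV. ?G ?x $ i $ j * ?v $ i * ?v $ j) = 0"
      using null[OF \<tau>I] metric_coord_eq[OF g cat[OF \<tau>], of "velocity A \<gamma> \<tau>" "velocity A \<gamma> \<tau>"]
      by (simp add: light_cone_def velA xg)
    have Gd: "(\<lambda>y. ?G y $ i $ j) differentiable (at ?x)" for i j
      using g c x smooth_on_imp_differentiable unfolding lorentzian_manifold_def by blast
    have conf: "metric_coord A (conformal h g) c = (\<lambda>y. f y *\<^sub>R ?G y)"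
      by (rule ext) (simp add: metric_coord_conformal f_def)
    have chr: "(\<Sum>i\<in>UNIV. \<Sum>j\<in>UNIV. christoffel (metric_coord A (conformal h g) c) k i j ?x * ?v $ i * ?v $ j)
      = (\<Sum>i\<in>UNIV. \<Sum>j\<in>UNIV. christoffel ?G k i j ?x * ?v $ i * ?v $ j) + ?D / ?H * ?v $ k"
      unfolding conf
      by (rule christoffel_conformal_null[OF Gd fd _ _ _ nullv])
        (use fx metric_coord_invertible[OF g cat[OF \<tau>]] metric_coord_sym[OF g cat[OF \<tau>]] xg in auto)
    have geq: "?a'' $ k + (\<Sum>i\<in>UNIV. \<Sum>j\<in>UNIV. christoffel ?G k i j ?x * ?v $ i * ?v $ j) = 0"
      using geodesicD(2)[OF geo \<tau>I cat[OF \<tau>], of k] unfolding velA xg a_def .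
    have "(\<Sum>i\<in>UNIV. \<Sum>j\<in>UNIV. christoffel (metric_coord A (conformal h g) c) k i j ?x
               * (inverse ?H *\<^sub>R ?v) $ i * (inverse ?H *\<^sub>R ?v) $ j)
      = inverse ?H * inverse ?H * (\<Sum>i\<in>UNIV. \<Sum>j\<in>UNIV. christoffel (metric_coord A (conformal h g) c) k i j ?x * ?v $ i * ?v $ j)"
      by (simp add: sum_distrib_left mult_ac)
    \<comment> \<open>The old geodesic equation replaces the Christoffel term by -a''. What remains,
      -a''/H^2 + (D/H^3) a', is the negative of the new acceleration.\<close>
    also have "\<dots> = inverse ?H * inverse ?H * (- ?a'' $ k + ?D / ?H * ?v $ k)"
      using geq chr by simp
    finally show ?thesis
      unfolding vel[OF \<tau>] acc xg using fx by (simp add: field_simps)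
  qed
qed

theorem conformal_reparam_null_geodesic:
  assumes g: "lorentzian_manifold A g" and h: "smooth_fun A h" and pos: "\<forall>p. h p > 0"
    and \<gamma>: "null_geodesic A g (\<gamma>, I)" and rep: "conformal_reparam h s (\<gamma>, I) (\<gamma>', I')"
  shows "null_geodesic A (conformal h g) (\<gamma>', I')"
    and "\<tau> \<in> I \<Longrightarrow> velocity A \<gamma>' (s \<tau>) = tscale (1 / h (\<gamma> \<tau>)) (velocity A \<gamma> \<tau>)"
proof -
  note A = lorentzian_smooth_atlas[OF g]
  have geo: "geodesic A g (\<gamma>, I)" and null: "\<And>\<tau>. \<tau> \<in> I \<Longrightarrow> velocity A \<gamma> \<tau> \<in> light_cone A g (\<gamma> \<tau>)"
    using \<gamma> unfolding null_geodesic_def by auto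
  note sm = geodesicD(1)[OF geo]
  note I = smooth_curveD(2,3)[OF sm]
  have s: "\<forall>\<tau>\<in>I. (s has_real_derivative h (\<gamma> \<tau>)) (at \<tau>)"
    and I': "I' = s ` I" and \<gamma>': "\<And>\<tau>. \<tau> \<in> I \<Longrightarrow> \<gamma>' (s \<tau>) = \<gamma> \<tau>" and ext: "\<gamma>' \<in> extensional I'"
    using rep unfolding conformal_reparam_def by auto
  have hpos: "\<forall>\<tau>\<in>I. h (\<gamma> \<tau>) > 0" using pos by blast
  note R = increasing_reparam[OF I s hpos]
  note C = conformal_reparam_chart[OF g h pos \<gamma> rep]
  show vel: "velocity A \<gamma>' (s \<tau>) = tscale (1 / h (\<gamma> \<tau>)) (velocity A \<gamma> \<tau>)" if "\<tau> \<in> I" for \<tau>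
  proof
    fix c
    show "velocity A \<gamma>' (s \<tau>) c = tscale (1 / h (\<gamma> \<tau>)) (velocity A \<gamma> \<tau>) c"
    proof (cases "c \<in> charts_at A (\<gamma> \<tau>)")
      case True
      then have "c \<in> A" "\<tau> \<in> {\<tau>\<in>I. \<gamma> \<tau> \<in> fst c}" using that by (auto simp: charts_at_def)
      from C(4)[OF this] True show ?thesis by (simp add: velocity_def tscale_def \<gamma>'[OF that])
    next
      case False
      then show ?thesis by (simp add: velocity_def tscale_def \<gamma>'[OF that])
    qed
  qed
  \<comment> \<open>\<open>smooth_curve\<close> also asks for continuity into the manifold, without
    reference to charts; it is inherited from the old curve through the continuous inverse of
    \<open>s\<close>.\<close>
  have cont: "continuous_on I' \<gamma>'"
  proof -
    have "continuous_on (s ` I) (\<lambda>\<sigma>. \<gamma> (inv_into I s \<sigma>))"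
    proof (rule continuous_on_compose2[OF smooth_curveD(5)[OF sm]])
      show "continuous_on (s ` I) (inv_into I s)"
        using R(5) by (blast intro: continuous_at_imp_continuous_on DERIV_isCont)
    qed (auto intro: inv_into_into)
    then show ?thesis
      unfolding I' by (rule continuous_on_eq) (use \<gamma>' R(2) in auto)
  qed
  have "smooth_curve A (\<gamma>', I')"
    unfolding smooth_curve_def
    using smooth_curveD(1)[OF sm] R(3) R(4)[OF order.refl I(1)] ext cont C(3) C(1) by (auto simp: I')
  moreover have "vector_derivative (\<lambda>t. vector_derivative (snd c \<circ> \<gamma>') (at t)) (at \<sigma>) $ k
          + (\<Sum>i\<in>UNIV. \<Sum>j\<in>UNIV. christoffel (metric_coord A (conformal h g) c) k i j (snd c (\<gamma>' \<sigma>))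
               * velocity A \<gamma>' \<sigma> c $ i * velocity A \<gamma>' \<sigma> c $ j) = 0"
    if \<sigma>: "\<sigma> \<in> I'" and c: "c \<in> charts_at A (\<gamma>' \<sigma>)" for \<sigma> c k
  proof -
    obtain \<tau> where \<tau>: "\<tau> \<in> I" "\<sigma> = s \<tau>" using \<sigma> I' by blast
    have "c \<in> A" "\<tau> \<in> {\<tau>\<in>I. \<gamma> \<tau> \<in> fst c}" using \<tau> c by (auto simp: charts_at_def \<gamma>')
    from C(5)[OF this, of k] c show ?thesis by (simp add: velocity_def \<tau> \<gamma>')
  qed
  ultimately have "geodesic A (conformal h g) (\<gamma>', I')"
    unfolding geodesic_def by blast
  moreover have "velocity A \<gamma>' \<sigma> \<in> light_cone A (conformal h g) (\<gamma>' \<sigma>)" if \<sigma>: "\<sigma> \<in> I'" for \<sigma>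
  proof -
    obtain \<tau> where \<tau>: "\<tau> \<in> I" "\<sigma> = s \<tau>" using \<sigma> I' by blast
    let ?u = "velocity A \<gamma> \<tau>" and ?k = "1 / h (\<gamma> \<tau>)"
    have u: "?u \<in> tangent_space A (\<gamma> \<tau>)" "?u \<noteq> (\<lambda>c. 0)" "g (\<gamma> \<tau>) ?u ?u = 0"
      using null[OF \<tau>(1)] by (auto simp: light_cone_def)
    have "tscale ?k ?u \<noteq> (\<lambda>c. 0)"
      using u(2) hpos \<tau>(1) by (force simp: tscale_def fun_eq_iff)
    then show ?thesis
      using tscale_in_tangent_space[OF A u(1)] tangent_form_tscale[OF lorentzian_tangent_form[OF g] A u(1,1)] u(3)
      by (simp add: light_cone_def vel[OF \<tau>(1)] \<tau>(2) \<gamma>'[OF \<tau>(1)] conformal_def)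
  qed
  ultimately show "null_geodesic A (conformal h g) (\<gamma>', I')"
    unfolding null_geodesic_def by blast
qed

text \<open>One inclusion is the velocity formula. The other requires that every curve of the family
  actually has a conformal reparametrization, which is where the antiderivative of \<open>h\<close>
  along the curve is needed.\<close>

theorem velocity_set_conformal_family:
  assumes g: "lorentzian_manifold A g" and h: "smooth_fun A h" and pos: "\<forall>p. h p > 0"
    and L: "\<And>\<gamma> I. (\<gamma>, I) \<in> L \<Longrightarrow> null_geodesic A g (\<gamma>, I)"
  shows "velocity_set A (conformal_family h L) p = {tscale (1 / h p) u | u. u \<in> velocity_set A L p}"
proof
  show "velocity_set A (conformal_family h L) p \<subseteq> {tscale (1 / h p) u | u. u \<in> velocity_set A L p}"
  proof
    fix v assume "v \<in> velocity_set A (conformal_family h L) p"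
    then obtain \<gamma>' I' \<sigma> \<gamma> I s where *: "v = velocity A \<gamma>' \<sigma>" "\<sigma> \<in> I'" "\<gamma>' \<sigma> = p"
      "(\<gamma>, I) \<in> L" "conformal_reparam h s (\<gamma>, I) (\<gamma>', I')"
      unfolding velocity_set_def conformal_family_def by fastforce
    then obtain \<tau> where \<tau>: "\<tau> \<in> I" "\<sigma> = s \<tau>" "\<gamma> \<tau> = p"
      unfolding conformal_reparam_def by auto
    have "v = tscale (1 / h p) (velocity A \<gamma> \<tau>)"
      using conformal_reparam_null_geodesic(2)[OF g h pos L[OF *(4)] *(5) \<tau>(1)] \<tau> *(1) by simp
    then show "v \<in> {tscale (1 / h p) u | u. u \<in> velocity_set A L p}"
      using *(4) \<tau> unfolding velocity_set_def by blast
  qed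
  show "{tscale (1 / h p) u | u. u \<in> velocity_set A L p} \<subseteq> velocity_set A (conformal_family h L) p"
  proof clarify
    fix u assume "u \<in> velocity_set A L p"
    then obtain \<gamma> I \<tau> where *: "u = velocity A \<gamma> \<tau>" "(\<gamma>, I) \<in> L" "\<tau> \<in> I" "\<gamma> \<tau> = p"
      unfolding velocity_set_def by blast
    have sm: "smooth_curve A (\<gamma>, I)"
      using L[OF *(2)] geodesicD(1) unfolding null_geodesic_def by blast
    obtain s \<gamma>' I' where rep: "conformal_reparam h s (\<gamma>, I) (\<gamma>', I')"
      using conformal_reparam_exists[OF smooth_curveD(2,3)[OF sm]
        smooth_fun_continuous_on_curve[OF lorentzian_smooth_atlas[OF g] h sm] pos] by blast
    then have "(\<gamma>', I') \<in> conformal_family h L"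
      using *(2) unfolding conformal_family_def by blast
    moreover have "s \<tau> \<in> I'" "\<gamma>' (s \<tau>) = p"
      using * rep unfolding conformal_reparam_def by auto
    moreover have "tscale (1 / h p) u = velocity A \<gamma>' (s \<tau>)"
      using conformal_reparam_null_geodesic(2)[OF g h pos L[OF *(2)] rep *(3)] * by simp
    ultimately show "tscale (1 / h p) u \<in> velocity_set A (conformal_family h L) p"
      unfolding velocity_set_def by blast
  qed
qed

section \<open>Scaling of surfaces in a tangent space\<close>

lemma tscale_tscale [simp]: "tscale a (tscale b u) = tscale (a * b) u"
  by (simp add: tscale_def)

lemma tscale_1 [simp]: "tscale 1 u = u"
  by (simp add: tscale_def)

lemma tscale_inject: "a \<noteq> 0 \<Longrightarrow> tscale a u = tscale a v \<longleftrightarrow> u = v"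
  by (simp add: tscale_def fun_eq_iff)

lemma image_tscale_tscale [simp]: "tscale a ` tscale b ` S = tscale (a * b) ` S"
  by (simp add: image_image)

lemma image_tscale_1 [simp]: "tscale 1 ` S = S"
  by simp

lemma tscale_subset_tangent_space:
  assumes "smooth_atlas A" "S \<subseteq> tangent_space A p"
  shows "tscale a ` S \<subseteq> tangent_space A p"
  using tscale_in_tangent_space[OF assms(1)] assms(2) by blast

lemma continuous_on_tscale: "continuous_on S (tscale a)"
  unfolding tscale_def
  by (intro continuous_on_coordinatewise_then_product continuous_intros continuous_on_subset[OF continuous_on_product_coordinates] subset_UNIV)

lemma homeomorphism_tscale:
  assumes "a \<noteq> 0"
  shows "homeomorphism S (tscale a ` S) (tscale a) (tscale (1 / a))"
  unfolding homeomorphism_def using assms by (auto simp: continuous_on_tscale)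

text \<open>Smoothness of a parametrization is required only for charts around p. At all other
  charts the components of tangent vectors are 0, so those components of \<open>F\<close> are
  constant on \<open>U\<close>.\<close>

lemma local_param_has_derivative:
  assumes S: "S \<subseteq> tangent_space A p" and F: "local_param A p S U F" and x: "x \<in> U"
  shows "((\<lambda>y. F y c) has_derivative (\<lambda>w. tderiv F x w c)) (at x)"
proof (cases "c \<in> charts_at A p")
  case True
  then have "smooth_on U (\<lambda>y. F y c)" using F unfolding local_param_def by blast
  from smooth_on_imp_has_derivative[OF this x] show ?thesis by (simp add: tderiv_def)
next
  case False
  have 0: "F y c = 0" if "y \<in> U" for y
  proof -
    have "F y \<in> S" using F that unfolding local_param_def by blast
    with S have "F y \<in> tangent_space A p" by blast
    then show ?thesis using False by (rule tangent_spaceD(1))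
  qed
  have U: "open U" using F unfolding local_param_def by blast
  have "((\<lambda>y. F y c) has_derivative (\<lambda>w. 0)) (at x)"
    by (rule has_derivative_transform_within_open[OF has_derivative_const[of 0] U x]) (simp add: 0)
  then show ?thesis
    by (simp add: tderiv_def frechet_derivative_eqI)
qed

text \<open>Differentiates the transformation law of tangent vectors: the coordinate change at the
  fixed point p is a bounded linear map, so it commutes with the derivative, and derivatives are
  unique.\<close>

lemma tderiv_in_tangent_space:
  assumes A: "smooth_atlas A" and S: "S \<subseteq> tangent_space A p" and F: "local_param A p S U F" and x: "x \<in> U"
  shows "tderiv F x w \<in> tangent_space A p"
proof (rule tangent_spaceI)
  have U: "open U" and FU: "\<And>y. y \<in> U \<Longrightarrow> F y \<in> tangent_space A p"
    using F S unfolding local_param_def by blast+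
  note D = local_param_has_derivative[OF S F x]
  show "tderiv F x w c = 0" if "c \<notin> charts_at A p" for c
  proof -
    have "((\<lambda>y. F y c) has_derivative (\<lambda>w. 0)) (at x)"
      by (rule has_derivative_transform_within_open[OF has_derivative_const[of 0] U x])
        (simp add: tangent_spaceD(1)[OF FU that])
    from has_derivative_unique[OF D this] show ?thesis by meson
  qed
  show "tderiv F x w d = coord_change c d p (tderiv F x w c)"
    if c: "c \<in> charts_at A p" and d: "d \<in> charts_at A p" for c d
  proof -
    have "bounded_linear (coord_change c d p)"
      using coord_change_has_derivative[OF A c d] has_derivative_bounded_linear by blast
    from bounded_linear.has_derivative[OF this D]
    have "((\<lambda>y. F y d) has_derivative (\<lambda>w. coord_change c d p (tderiv F x w c))) (at x)"
      by (rule has_derivative_transform_within_open[OF _ U x]) (simp add: tangent_spaceD(2)[OF FU c d, symmetric])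
    from has_derivative_unique[OF D this] show ?thesis by meson
  qed
qed

lemma tderiv_eq_sum:
  assumes S: "S \<subseteq> tangent_space A p" and F: "local_param A p S U F" and x: "x \<in> U"
  shows "tderiv F x w = (\<lambda>d. \<Sum>i\<in>UNIV. (w $ i) *\<^sub>R tderiv F x (axis i 1) d)"
proof
  fix d
  note l = has_derivative_linear[OF local_param_has_derivative[OF S F x, of d]]
  have "tderiv F x w d = tderiv F x (\<Sum>i\<in>UNIV. w $ i *\<^sub>R axis i 1) d"
    by (simp add: basis_expansion scalar_mult_eq_scaleR[symmetric])
  also have "\<dots> = (\<Sum>i\<in>UNIV. w $ i *\<^sub>R tderiv F x (axis i 1) d)"
    by (simp add: linear_sum[OF l] linear_scale[OF l])
  finally show "tderiv F x w d = (\<Sum>i\<in>UNIV. w $ i *\<^sub>R tderiv F x (axis i 1) d)" .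
qed

lemma tderiv_tscale:
  assumes S: "S \<subseteq> tangent_space A p" and F: "local_param A p S U F" and x: "x \<in> U"
  shows "tderiv (\<lambda>y. tscale a (F y)) x w = tscale a (tderiv F x w)"
proof
  fix c
  have "((\<lambda>y. a *\<^sub>R F y c) has_derivative (\<lambda>w. a *\<^sub>R tderiv F x w c)) (at x)"
    by (intro has_derivative_scaleR_right local_param_has_derivative[OF S F x])
  from frechet_derivative_eqI[OF this]
  show "tderiv (\<lambda>y. tscale a (F y)) x w c = tscale a (tderiv F x w) c"
    by (simp add: tderiv_def tscale_def)
qed

section \<open>Local parametrizations of scaled surfaces\<close>

lemma local_param_tscale:
  assumes S: "S \<subseteq> tangent_space A p" and F: "local_param A p S U F" and a: "a \<noteq> 0"
  shows "local_param A p (tscale a ` S) U (\<lambda>x. tscale a (F x))"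
proof -
  have U: "open U" and sm: "\<And>c. c \<in> charts_at A p \<Longrightarrow> smooth_on U (\<lambda>x. F x c)"
    and imm: "\<And>x w. x \<in> U \<Longrightarrow> tderiv F x w = (\<lambda>c. 0) \<Longrightarrow> w = 0"
    and sub: "F ` U \<subseteq> S" and op: "openin (top_of_set S) (F ` U)"
    using F unfolding local_param_def by auto
  obtain G where G: "homeomorphism U (F ` U) F G"
    using F unfolding local_param_def by blast
  have img: "(\<lambda>x. tscale a (F x)) ` U = tscale a ` F ` U" by (simp add: image_image)
  have "smooth_on U (\<lambda>x. tscale a (F x) c)" if "c \<in> charts_at A p" for c
    using sm[OF that] U unfolding smooth_on_def tscale_def by (auto intro: Ck_on_scaleR Ck_on_const)
  moreover have "w = 0" if "x \<in> U" "tderiv (\<lambda>x. tscale a (F x)) x w = (\<lambda>c. 0)" for x w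
  proof (rule imm[OF that(1)])
    have "tscale (1 / a) (tscale a (tderiv F x w)) = tscale (1 / a) (\<lambda>c. 0)"
      using that tderiv_tscale[OF S F that(1)] by metis
    then show "tderiv F x w = (\<lambda>c. 0)" using a by (simp add: tscale_def[of _ "\<lambda>c. 0"])
  qed
  moreover have "openin (top_of_set (tscale a ` S)) (tscale a ` F ` U)"
    using homeomorphism_imp_open_map[OF homeomorphism_tscale[OF a] op] .
  moreover have "\<exists>G. homeomorphism U (tscale a ` F ` U) (\<lambda>x. tscale a (F x)) G"
    using homeomorphism_compose[OF G homeomorphism_tscale[OF a]] unfolding o_def by blast
  ultimately show ?thesis
    unfolding local_param_def img using U sub by blast
qed

text \<open>Scaling back by 1/a shows that no parametrizations arise other than the scaled ones.
  This matters because area and curvature quantify over all local parametrizations.\<close>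

lemma local_param_tscaleE:
  assumes A: "smooth_atlas A" and S: "S \<subseteq> tangent_space A p" and a: "a \<noteq> 0"
    and F': "local_param A p (tscale a ` S) U F'"
  obtains F where "local_param A p S U F" "F' = (\<lambda>x. tscale a (F x))"
proof
  show "local_param A p S U (\<lambda>x. tscale (1 / a) (F' x))"
    using local_param_tscale[OF tscale_subset_tangent_space[OF A S] F', of "1 / a"] a by simp
  show "F' = (\<lambda>x. tscale a (tscale (1 / a) (F' x)))" using a by simp
qed

section \<open>First fundamental forms: scaling, smoothness and nondegeneracy\<close>

lemma first_form_tscale:
  assumes A: "smooth_atlas A" and S: "S \<subseteq> tangent_space A p" and F: "local_param A p S U F"
    and b: "tangent_form A p b" and x: "x \<in> U"
  shows "first_form (\<lambda>u v. k * b u v) (\<lambda>x. tscale a (F x)) x = (k * a\<^sup>2) *\<^sub>R first_form b F x"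
  using tderiv_in_tangent_space[OF A S F x]
  by (simp add: first_form_def vec_eq_iff tderiv_tscale[OF S F x] tangent_form_tscale[OF b A] power2_eq_square)

text \<open>In one fixed chart around p the form \<open>b\<close> has a constant matrix, so the
  entries are polynomials in the partial derivatives of the components of \<open>F\<close>. This
  serves the Christoffel symbols and the measurability of the area density.\<close>

lemma first_form_smooth:
  assumes A: "smooth_atlas A" and S: "S \<subseteq> tangent_space A p" and F: "local_param A p S U F"
    and b: "tangent_form A p b"
  shows "smooth_on U (\<lambda>x. first_form b F x $ i $ j)"
proof -
  obtain c where c: "c \<in> charts_at A p" using charts_at_nonempty[OF A] by blast
  define M where "M k l = b (tangent_of_coord A c p (axis k 1)) (tangent_of_coord A c p (axis l 1))" for k l
  have U: "open U" and sm: "smooth_on U (\<lambda>x. F x c)"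
    using F c unfolding local_param_def by auto
  let ?T = "\<lambda>i x. frechet_derivative (\<lambda>x. F x c) (at x) (axis i 1)"
  have T: "Ck_on n U (\<lambda>x. ?T i x \<bullet> axis k 1)" for n i k
    using smooth_on_frechet_derivative[OF sm, of "axis i 1"] U unfolding smooth_on_def
    by (intro Ck_on_inner Ck_on_const) auto
  have eq: "first_form b F x $ i $ j = (\<Sum>k\<in>UNIV. \<Sum>l\<in>UNIV. - M k l * (?T i x \<bullet> axis k 1) * (?T j x \<bullet> axis l 1))"
    if "x \<in> U" for x
    unfolding first_form_def
    using tangent_form_coord[OF b A c tderiv_in_tangent_space[OF A S F that] tderiv_in_tangent_space[OF A S F that],
        of "axis i 1" "axis j 1"]
    by (simp add: M_def tderiv_def inner_axis sum_negf)
  have "smooth_on U (\<lambda>x. \<Sum>k\<in>UNIV. \<Sum>l\<in>UNIV. - M k l * (?T i x \<bullet> axis k 1) * (?T j x \<bullet> axis l 1))"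
    unfolding smooth_on_def by (intro allI Ck_on_sum Ck_on_mult Ck_on_const U T)
  then show ?thesis using smooth_on_cong[OF U eq] by simp
qed

text \<open>A kernel vector w yields a tangent vector that is \<open>b\<close>-orthogonal to both
  coordinate vectors, hence to itself; positivity of the induced metric then forces w = 0.\<close>

lemma first_form_invertible:
  assumes A: "smooth_atlas A" and S: "S \<subseteq> tangent_space A p" and F: "local_param A p S U F"
    and b: "tangent_form A p b" and x: "x \<in> U" and ind: "induces_riemannian A p b S"
  shows "invertible (first_form b F x)"
proof -
  have "w = 0" if w: "first_form b F x *v w = 0" for w
  proof (rule ccontr)
    assume "w \<noteq> 0"
    then have pos: "- b (tderiv F x w) (tderiv F x w) > 0"
      using ind F x unfolding induces_riemannian_def by blast
    let ?t = "\<lambda>i. tderiv F x (axis i 1)"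
    note T = tderiv_in_tangent_space[OF A S F x]
    have sum: "b (tderiv F x w) v = (\<Sum>i\<in>UNIV. w $ i * b (?t i) v)" if "v \<in> tangent_space A p" for v
      using tangent_form_sum_left[where J = UNIV and t = ?t and w = "\<lambda>i. w $ i", OF b A T that finite]
      unfolding tderiv_eq_sum[OF S F x, of w, symmetric] by simp
    have "b (?t i) (tderiv F x w) = 0" for i
    proof -
      have sym: "b u v = b v u" if "u \<in> tangent_space A p" "v \<in> tangent_space A p" for u v
        using b that unfolding tangent_form_def by blast
      have "b (?t i) (tderiv F x w) = (\<Sum>j\<in>UNIV. w $ j * b (?t j) (?t i))"
        unfolding sym[OF T T, of "axis i 1"] by (rule sum[OF T])
      also have "\<dots> = (\<Sum>j\<in>UNIV. b (?t i) (?t j) * w $ j)"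
        by (intro sum.cong refl) (metis sym[OF T T] mult.commute)
      also have "\<dots> = - (first_form b F x *v w) $ i"
        by (simp add: matrix_vector_mult_def first_form_def sum_negf)
      finally show ?thesis by (simp add: w)
    qed
    with sum[OF T] pos show False by simp
  qed
  then show ?thesis
    using matrix_left_invertible_ker invertible_left_inverse by blast
qed

section \<open>Gaussian curvature under scaling\<close>

lemma pderiv_at_cong_open:
  assumes "open U" "x \<in> U" "\<And>y. y \<in> U \<Longrightarrow> f y = g y"
  shows "pderiv_at i f x = pderiv_at i g x"
  unfolding pderiv_at_def by (simp only: frechet_derivative_cong_open[OF assms])

text \<open>A constant factor changes neither the Christoffel symbols nor the curvature tensor with
  one upper index. Lowering that index gives r and the determinant in dimension 2 gives r^2, so 1/r
  is left. The relation between the matrices is assumed on a neighbourhood because it has to be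
  differentiated.\<close>

lemma gauss_curv_coord_scaleR:
  assumes U: "open U" "x \<in> U" and N: "\<And>y. y \<in> U \<Longrightarrow> N y = r *\<^sub>R M y" and r: "r \<noteq> 0"
    and M: "\<And>y i j. y \<in> U \<Longrightarrow> (\<lambda>y. M y $ i $ j) differentiable (at y)"
    and inv: "\<And>y. y \<in> U \<Longrightarrow> invertible (M y)"
  shows "gauss_curv_coord N x = gauss_curv_coord M x / r"
proof -
  have chr: "christoffel N k i j y = christoffel M k i j y" if y: "y \<in> U" for k i j y
  proof -
    have "christoffel N k i j y = christoffel (\<lambda>y. r *\<^sub>R M y) k i j y"
    proof -
      have "pderiv_at i (\<lambda>y. N y $ j $ l) y = pderiv_at i (\<lambda>y. (r *\<^sub>R M y) $ j $ l) y" for i j l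
        by (rule pderiv_at_cong_open[OF U(1) y]) (simp add: N)
      then show ?thesis by (simp only: christoffel_def N[OF y])
    qed
    \<comment> \<open>The conformal factor is the constant r, so its partial derivatives vanish, and
      with them the correction.\<close>
    also have "\<dots> = christoffel M k i j y"
      by (subst christoffel_conformal[of M y "\<lambda>_. r"]) (use M[OF y] inv[OF y] r in \<open>simp_all add: pderiv_at_def\<close>)
    finally show ?thesis .
  qed
  have "riemann N l k i j x = riemann M l k i j x" for l k i j
    unfolding riemann_def chr[OF U(2)]
    by (simp only: pderiv_at_cong_open[OF U chr])
  moreover have "det (r *\<^sub>R M x) = r * (r * det (M x))"
    by (simp add: det_2 algebra_simps)
  ultimately show ?thesis
    unfolding gauss_curv_coord_def using r
    by (simp add: N[OF U(2)] sum_distrib_left[symmetric] mult.assoc)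
qed

text \<open>Describing the whole set of candidates as an image, and not one value, allows both
  having a unique value and failing to have one to be transferred.\<close>

lemma gauss_values_tscale:
  assumes A: "smooth_atlas A" and S: "S \<subseteq> tangent_space A p" and b: "tangent_form A p b"
    and ind: "induces_riemannian A p b S" and a: "a \<noteq> 0" and k: "k \<noteq> 0"
  shows "gauss_values A p (\<lambda>u v. k * b u v) (tscale a ` S) (tscale a u)
    = (\<lambda>v. v / (k * a\<^sup>2)) ` gauss_values A p b S u"
proof -
  have *: "gauss_curv_coord (first_form (\<lambda>u v. k * b u v) (\<lambda>x. tscale a (F x))) x
      = gauss_curv_coord (first_form b F) x / (k * a\<^sup>2)" if F: "local_param A p S U F" and x: "x \<in> U" for U F x
  proof (rule gauss_curv_coord_scaleR[OF _ x])
    show "open U" using F unfolding local_param_def by blast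
  qed (use first_form_tscale[OF A S F b] first_form_invertible[OF A S F b _ ind] a k
      smooth_on_imp_differentiable[OF first_form_smooth[OF A S F b]] in auto)
  show ?thesis
  proof (intro subset_antisym subsetI)
    fix z assume "z \<in> gauss_values A p (\<lambda>u v. k * b u v) (tscale a ` S) (tscale a u)"
    then obtain U F' x where z: "z = gauss_curv_coord (first_form (\<lambda>u v. k * b u v) F') x"
      "local_param A p (tscale a ` S) U F'" "x \<in> U" "F' x = tscale a u"
      unfolding gauss_values_def by blast
    obtain F where F: "local_param A p S U F" "F' = (\<lambda>x. tscale a (F x))"
      using local_param_tscaleE[OF A S a z(2)] .
    then have "gauss_curv_coord (first_form b F) x \<in> gauss_values A p b S u"
      using z(3,4) tscale_inject[OF a] unfolding gauss_values_def by blast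
    then show "z \<in> (\<lambda>v. v / (k * a\<^sup>2)) ` gauss_values A p b S u"
      using *[OF F(1) z(3)] z(1) F(2) by blast
  next
    fix z assume "z \<in> (\<lambda>v. v / (k * a\<^sup>2)) ` gauss_values A p b S u"
    then obtain U F x where z: "z = gauss_curv_coord (first_form b F) x / (k * a\<^sup>2)"
      "local_param A p S U F" "x \<in> U" "F x = u"
      unfolding gauss_values_def by blast
    then show "z \<in> gauss_values A p (\<lambda>u v. k * b u v) (tscale a ` S) (tscale a u)"
      unfolding gauss_values_def using local_param_tscale[OF S z(2) a] *[OF z(2,3)]
      by (intro CollectI exI[of _ U] exI[of _ "\<lambda>x. tscale a (F x)"] exI[of _ x]) simp
  qed
qed

lemma is_singleton_image: "inj_on f X \<Longrightarrow> is_singleton (f ` X) \<longleftrightarrow> is_singleton X"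
  by (simp add: is_singleton_altdef card_image)

lemma gauss_curvature_tscale:
  assumes "smooth_atlas A" "S \<subseteq> tangent_space A p" "tangent_form A p b"
    "induces_riemannian A p b S" "a \<noteq> 0" "k \<noteq> 0"
  shows "gauss_curvature A p (\<lambda>u v. k * b u v) (tscale a ` S) (tscale a u)
    = gauss_curvature A p b S u / (k * a\<^sup>2)"
proof -
  let ?V = "gauss_values A p b S u" and ?r = "\<lambda>v. v / (k * a\<^sup>2)"
  have inj: "inj_on ?r ?V" using assms(5,6) by (auto intro: inj_onI)
  show ?thesis
  proof (cases "is_singleton ?V")
    case True
    then obtain v where "?V = {v}" by (rule is_singletonE)
    then show ?thesis
      unfolding gauss_curvature_def gauss_values_tscale[OF assms] by simp
  next
    \<comment> \<open>Division by the factor is injective, so the scaled set is no singleton either;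
      both curvatures take the default 0, and 0 divided by the factor is 0.\<close>
    case False
    then show ?thesis
      unfolding gauss_curvature_def gauss_values_tscale[OF assms] is_singleton_image[OF inj] by simp
  qed
qed

section \<open>Area under scaling\<close>

text \<open>The push-forward under scaling by a, multiplied by r. Its sigma-algebra is the Borel
  trace on the scaled set because \<open>volume_measures\<close> demands exactly that one.\<close>

definition scaled_measure :: "real \<Rightarrow> real \<Rightarrow> 'm tangent measure \<Rightarrow> 'm tangent measure" where
  "scaled_measure a r \<mu> =
     scale_measure (ennreal r) (distr \<mu> (restrict_space borel (tscale a ` space \<mu>)) (tscale a))"

lemma measurable_tscale:
  "tscale a \<in> restrict_space borel S \<rightarrow>\<^sub>M restrict_space borel (tscale a ` S)"
  by (intro measurable_restrict_space3 borel_measurable_continuous_onI continuous_on_tscale) auto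

text \<open>Scaling is a measurable bijection with measurable inverse, so measurability passes in
  both directions. The last two claims therefore extend to non-measurable sets and functions, where
  both sides are 0; this matters for 1/K, whose measurability is not established here.\<close>

lemma scaled_measure_basic:
  fixes S :: "'m tangent set" and f :: "'m tangent \<Rightarrow> real"
  assumes \<mu>: "space \<mu> = S" "sets \<mu> = sets (restrict_space borel S)"
  shows "space (scaled_measure a r \<mu>) = tscale a ` S"
    and "sets (scaled_measure a r \<mu>) = sets (restrict_space borel (tscale a ` S))"
    and "X \<subseteq> S \<Longrightarrow> a \<noteq> 0 \<Longrightarrow> emeasure (scaled_measure a r \<mu>) (tscale a ` X) = ennreal r * emeasure \<mu> X"
    and "a \<noteq> 0 \<Longrightarrow> r \<ge> 0 \<Longrightarrow> (\<integral>u. f u \<partial>scaled_measure a r \<mu>) = r * (\<integral>u. f (tscale a u) \<partial>\<mu>)"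
proof -
  let ?N = "restrict_space borel (tscale a ` S)"
  show "space (scaled_measure a r \<mu>) = tscale a ` S"
    by (simp add: scaled_measure_def space_scale_measure space_restrict_space \<mu>)
  show "sets (scaled_measure a r \<mu>) = sets ?N"
    by (simp add: scaled_measure_def \<mu>)
  have m: "tscale a \<in> \<mu> \<rightarrow>\<^sub>M ?N"
    using measurable_tscale[of a S] measurable_cong_sets[OF \<mu>(2) refl] by blast
  have minv: "tscale (1 / a) \<in> ?N \<rightarrow>\<^sub>M \<mu>" if "a \<noteq> 0"
    using measurable_tscale[of "1 / a" "tscale a ` S"] that by (simp add: measurable_cong_sets[OF refl \<mu>(2)])
  have inv: "tscale a -` (tscale a ` X) \<inter> S = X" if "X \<subseteq> S" "a \<noteq> 0" for X
    using that by (auto simp: tscale_inject)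
  show "emeasure (scaled_measure a r \<mu>) (tscale a ` X) = ennreal r * emeasure \<mu> X" if X: "X \<subseteq> S" and a: "a \<noteq> 0"
  proof (cases "X \<in> sets \<mu>")
    case True
    have "tscale a ` X = tscale (1 / a) -` X \<inter> space ?N"
      using X a by (force simp: space_restrict_space)
    then have "tscale a ` X \<in> sets ?N"
      using measurable_sets[OF minv[OF a] True] by simp
    then show ?thesis
      by (simp add: scaled_measure_def \<mu>(1) emeasure_distr[OF m] inv[OF X a])
  next
    case False
    have "tscale a ` X \<notin> sets ?N"
      using measurable_sets[OF m, of "tscale a ` X"] False by (auto simp: \<mu>(1) inv[OF X a])
    then show ?thesis
      using False by (simp add: scaled_measure_def \<mu>(1) emeasure_notin_sets)
  qed
  show "(\<integral>u. f u \<partial>scaled_measure a r \<mu>) = r * (\<integral>u. f (tscale a u) \<partial>\<mu>)"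
    if a: "a \<noteq> 0" and r: "r \<ge> 0"
  proof (cases "f \<in> borel_measurable ?N")
    case True
    let ?D = "distr \<mu> ?N (tscale a)"
    have "scaled_measure a r \<mu> = density ?D (\<lambda>_. ennreal r)"
      by (rule measure_eqI) (simp_all add: scaled_measure_def \<mu>(1) emeasure_density_const)
    then have "(\<integral>u. f u \<partial>scaled_measure a r \<mu>) = (\<integral>u. r *\<^sub>R f u \<partial>?D)"
      using True r by (simp add: integral_density)
    also have "\<dots> = r * (\<integral>u. f (tscale a u) \<partial>\<mu>)"
      by (simp add: integral_distr[OF m True])
    finally show ?thesis .
  next
    case False
    \<comment> \<open>If the composite were measurable, composing it with the inverse scaling would
      make f measurable.\<close>
    have "(\<lambda>u. f (tscale a u)) \<notin> borel_measurable \<mu>"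
    proof
      assume "(\<lambda>u. f (tscale a u)) \<in> borel_measurable \<mu>"
      from measurable_compose[OF minv[OF a] this] show False
        using False a by simp
    qed
    moreover have "f \<notin> borel_measurable (scaled_measure a r \<mu>)"
      using False measurable_cong_sets[OF \<open>sets (scaled_measure a r \<mu>) = sets ?N\<close> refl] by blast
    ultimately show ?thesis
      using borel_measurable_integrable not_integrable_integral_eq by (metis mult_zero_right)
  qed
qed

text \<open>Makes scaling a bijection between the candidates for the two area measures: it yields
  injectivity and, with the roles exchanged, surjectivity.\<close>

lemma scaled_measure_inverse:
  fixes S :: "'m tangent set"
  assumes \<mu>: "space \<mu> = S" "sets \<mu> = sets (restrict_space borel S)" and "a \<noteq> 0" "r > 0"
  shows "scaled_measure (1 / a) (1 / r) (scaled_measure a r \<mu>) = \<mu>"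
proof -
  note 1 = scaled_measure_basic[OF \<mu>]
  note 2 = scaled_measure_basic[OF 1(1,2)]
  show ?thesis
  proof (rule measure_eqI)
    show "sets (scaled_measure (1 / a) (1 / r) (scaled_measure a r \<mu>)) = sets \<mu>"
      using 2(2)[of "1 / a" "1 / r" a r] assms(3) by (simp add: \<mu>)
    fix X assume "X \<in> sets (scaled_measure (1 / a) (1 / r) (scaled_measure a r \<mu>))"
    then have "X \<in> sets \<mu>" using 2(2)[of "1 / a" "1 / r" a r] assms(3) by (simp add: \<mu>)
    then have "X \<subseteq> S" using sets.sets_into_space \<mu>(1) by blast
    then show "emeasure (scaled_measure (1 / a) (1 / r) (scaled_measure a r \<mu>)) X = emeasure \<mu> X"
      using 2(3)[of "tscale a ` X" a "1 / a" "1 / r" r] 1(3)[of X a r] assms(3,4)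
      by (simp add: image_mono mult.assoc[symmetric] ennreal_mult[symmetric])
  qed
qed

text \<open>In dimension 2 the determinant of the first form takes the square of the factor, so the
  area density takes the factor itself. Every parametrization of the scaled surface comes from one
  of S, so the defining condition transfers.\<close>

lemma scaled_measure_in_volume_measures:
  assumes A: "smooth_atlas A" and S: "S \<subseteq> tangent_space A p" and b: "tangent_form A p b"
    and a: "a \<noteq> 0" and k: "k > 0" and \<mu>: "\<mu> \<in> volume_measures A p b S"
  shows "scaled_measure a (k * a\<^sup>2) \<mu> \<in> volume_measures A p (\<lambda>u v. k * b u v) (tscale a ` S)"
proof -
  let ?r = "k * a\<^sup>2"
  have r: "?r > 0" using a k by simp
  have sp: "space \<mu> = S" "sets \<mu> = sets (restrict_space borel S)"
    and vol: "\<And>U F B. local_param A p S U F \<Longrightarrow> B \<in> sets borel \<Longrightarrow> B \<subseteq> U \<Longrightarrow>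
      emeasure \<mu> (F ` B) = (\<integral>\<^sup>+x\<in>B. ennreal (sqrt (det (first_form b F x))) \<partial>lborel)"
    using \<mu> unfolding volume_measures_def by auto
  have "emeasure (scaled_measure a ?r \<mu>) (F' ` B) =
      (\<integral>\<^sup>+x\<in>B. ennreal (sqrt (det (first_form (\<lambda>u v. k * b u v) F' x))) \<partial>lborel)"
    if F': "local_param A p (tscale a ` S) U F'" and B: "B \<in> sets borel" "B \<subseteq> U" for U F' B
  proof -
    obtain F where F: "local_param A p S U F" "F' = (\<lambda>x. tscale a (F x))"
      using local_param_tscaleE[OF A S a F'] .
    have U: "open U" "F ` U \<subseteq> S" using F(1) unfolding local_param_def by auto
    let ?d = "\<lambda>x. sqrt (det (first_form b F x))"
    have cont: "continuous_on U (\<lambda>x. first_form b F x $ i $ j)" for i j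
      using first_form_smooth[OF A S F(1) b] unfolding smooth_on_def by (metis Ck_on.simps(1))
    have "continuous_on U ?d"
      unfolding det_2 by (intro continuous_intros cont)
    then have "continuous_on B ?d" using B(2) continuous_on_subset by blast
    \<comment> \<open>The density is continuous only inside \<open>U\<close>. Cutting it off to the
      Borel set B gives a function measurable on the whole plane, as needed to move the constant
      into the integral.\<close>
    then have "(\<lambda>x. indicator B x *\<^sub>R ?d x) \<in> borel_measurable borel"
      by (rule borel_measurable_continuous_on_indicator[OF B(1)])
    then have "(\<lambda>x. ennreal (indicator B x *\<^sub>R ?d x)) \<in> borel_measurable borel"
      by measurable
    also have "(\<lambda>x. ennreal (indicator B x *\<^sub>R ?d x)) = (\<lambda>x. ennreal (?d x) * indicator B x)"
      by (auto simp: indicator_def)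
    finally have meas: "(\<lambda>x. ennreal (?d x) * indicator B x) \<in> borel_measurable lborel" by simp
    have "emeasure (scaled_measure a ?r \<mu>) (F' ` B) = ennreal ?r * emeasure \<mu> (F ` B)"
      using scaled_measure_basic(3)[OF sp, of "F ` B" a ?r] U(2) B(2) a by (auto simp: F(2) image_image)
    also have "\<dots> = (\<integral>\<^sup>+x. ennreal ?r * (ennreal (?d x) * indicator B x) \<partial>lborel)"
      by (simp add: vol[OF F(1) B] nn_integral_cmult[OF meas])
    also have "\<dots> = (\<integral>\<^sup>+x\<in>B. ennreal (sqrt (det (first_form (\<lambda>u v. k * b u v) F' x))) \<partial>lborel)"
    proof (rule nn_integral_cong)
      fix x
      have "sqrt (det (first_form (\<lambda>u v. k * b u v) F' x)) = ?r * ?d x" if "x \<in> B"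
      proof -
        have "det (first_form (\<lambda>u v. k * b u v) F' x) = ?r\<^sup>2 * det (first_form b F x)"
          unfolding F(2) using that B(2) first_form_tscale[OF A S F(1) b]
          by (auto simp: det_2 power2_eq_square algebra_simps)
        then show ?thesis using r by (simp add: real_sqrt_mult)
      qed
      then show "ennreal ?r * (ennreal (?d x) * indicator B x) =
        ennreal (sqrt (det (first_form (\<lambda>u v. k * b u v) F' x))) * indicator B x"
        using r by (simp add: indicator_def ennreal_mult')
    qed
    finally show ?thesis .
  qed
  then show ?thesis
    unfolding volume_measures_def using scaled_measure_basic(1,2)[OF sp] by blast
qed

text \<open>The reverse inclusion applies the preceding lemma to the scaled data with 1/a and 1/k,
  which leads back to S and \<open>b\<close>.\<close>

lemma volume_measures_tscale:
  assumes A: "smooth_atlas A" and S: "S \<subseteq> tangent_space A p" and b: "tangent_form A p b"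
    and a: "a \<noteq> 0" and k: "k > 0"
  shows "volume_measures A p (\<lambda>u v. k * b u v) (tscale a ` S)
    = scaled_measure a (k * a\<^sup>2) ` volume_measures A p b S"
proof (intro subset_antisym subsetI)
  fix \<mu> assume \<mu>: "\<mu> \<in> volume_measures A p (\<lambda>u v. k * b u v) (tscale a ` S)"
  let ?\<nu> = "scaled_measure (1 / a) (1 / (k * a\<^sup>2)) \<mu>"
  have "scaled_measure (1 / a) (1 / k * (1 / a)\<^sup>2) \<mu> \<in>
     volume_measures A p (\<lambda>u v. 1 / k * (k * b u v)) (tscale (1 / a) ` tscale a ` S)"
    using a k by (intro scaled_measure_in_volume_measures[OF A tscale_subset_tangent_space[OF A S]
        tangent_form_scale[OF b] _ _ \<mu>]) auto
  then have "?\<nu> \<in> volume_measures A p b S"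
    using a k by (simp add: power_divide)
  moreover have "scaled_measure a (k * a\<^sup>2) ?\<nu> = \<mu>"
  proof -
    have "space \<mu> = tscale a ` S" "sets \<mu> = sets (restrict_space borel (tscale a ` S))"
      using \<mu> unfolding volume_measures_def by auto
    from scaled_measure_inverse[OF this, of "1 / a" "1 / (k * a\<^sup>2)"] show ?thesis using a k by simp
  qed
  ultimately show "\<mu> \<in> scaled_measure a (k * a\<^sup>2) ` volume_measures A p b S" by (metis imageI)
qed (use scaled_measure_in_volume_measures[OF A S b a k] in blast)

text \<open>Covers the default branch too, so the facts about \<open>scaled_measure\<close> apply
  without knowing that an area measure exists.\<close>

lemma volume_measure_space_sets:
  "space (volume_measure A p b S) = S"
  "sets (volume_measure A p b S) = sets (restrict_space borel S)"
proof -
  have "space (volume_measure A p b S) = S \<and> sets (volume_measure A p b S) = sets (restrict_space borel S)"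
  proof (cases "is_singleton (volume_measures A p b S)")
    case True
    then have "volume_measure A p b S \<in> volume_measures A p b S"
      by (metis volume_measure_def is_singleton_the_elem singletonI)
    then show ?thesis unfolding volume_measures_def by blast
  next
    case False
    then show ?thesis by (simp add: volume_measure_def space_restrict_space)
  qed
  then show "space (volume_measure A p b S) = S"
    "sets (volume_measure A p b S) = sets (restrict_space borel S)" by auto
qed

lemma volume_measure_tscale:
  assumes "smooth_atlas A" "S \<subseteq> tangent_space A p" "tangent_form A p b" "a \<noteq> 0" "k > 0"
  shows "volume_measure A p (\<lambda>u v. k * b u v) (tscale a ` S)
    = scaled_measure a (k * a\<^sup>2) (volume_measure A p b S)"
proof -
  let ?V = "volume_measures A p b S" and ?r = "scaled_measure a (k * a\<^sup>2)"
  have "scaled_measure (1 / a) (1 / (k * a\<^sup>2)) (?r \<mu>) = \<mu>" if "\<mu> \<in> ?V" for \<mu>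
    using that assms(4,5) unfolding volume_measures_def by (intro scaled_measure_inverse) auto
  then have inj: "inj_on ?r ?V" by (rule inj_on_inverseI)
  show ?thesis
  proof (cases "is_singleton ?V")
    case True
    then obtain v where "?V = {v}" by (rule is_singletonE)
    then show ?thesis
      unfolding volume_measure_def volume_measures_tscale[OF assms] by simp
  next
    case False
    \<comment> \<open>Without a unique candidate both sides are defaults; scaling must carry one
      null measure to the other.\<close>
    have "?r (null_measure (restrict_space borel S)) = null_measure (restrict_space borel (tscale a ` S))"
    proof (rule measure_eqI)
      have sp: "space (null_measure (restrict_space borel S)) = S"
        "sets (null_measure (restrict_space borel S)) = sets (restrict_space borel S)"
        by (simp_all add: space_restrict_space)
      note * = scaled_measure_basic[OF sp]
      show "sets (?r (null_measure (restrict_space borel S))) = sets (null_measure (restrict_space borel (tscale a ` S)))"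
        by (simp add: *(2))
      fix X assume "X \<in> sets (?r (null_measure (restrict_space borel S)))"
      then have "X \<subseteq> tscale a ` S" using sets.sets_into_space *(1) by blast
      then have "tscale (1 / a) ` X \<subseteq> S"
        using assms(4) by (force simp: subset_iff)
      show "emeasure (?r (null_measure (restrict_space borel S))) X =
         emeasure (null_measure (restrict_space borel (tscale a ` S))) X"
        using *(3)[of "tscale (1 / a) ` X" a "k * a\<^sup>2"] \<open>tscale (1 / a) ` X \<subseteq> S\<close> assms(4) by simp
    qed
    with False show ?thesis
      unfolding volume_measure_def volume_measures_tscale[OF assms] is_singleton_image[OF inj] by simp
  qed
qed

text \<open>If the area is infinite, \<open>measure\<close> is 0 on both sides, since the factor is
  positive.\<close>

lemma measure_volume_measure_tscale:
  assumes "smooth_atlas A" "S \<subseteq> tangent_space A p" "tangent_form A p b" "a \<noteq> 0" "k > 0"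
  shows "measure (volume_measure A p (\<lambda>u v. k * b u v) (tscale a ` S)) (tscale a ` S)
    = k * a\<^sup>2 * measure (volume_measure A p b S) S"
  unfolding volume_measure_tscale[OF assms] measure_def
  using scaled_measure_basic(3)[OF volume_measure_space_sets order.refl assms(4), of "k * a\<^sup>2" A p b S] assms(5)
  by (simp add: enn2real_mult)

section \<open>Conformal change of the DGC functions\<close>

lemma geodesic_familyD:
  assumes "geodesic_family A g L"
  shows "(\<gamma>, I) \<in> L \<Longrightarrow> null_geodesic A g (\<gamma>, I)"
    and "velocity_set A L p \<subseteq> tangent_space A p"
    and "induces_riemannian A p (g p) (velocity_set A L p)"
  using assms unfolding geodesic_family_def maximal_null_geodesic_def smooth_surface_def by auto

theorem mainTheorem2:
  fixes A :: "'m::{t2_space, second_countable_topology} chart set"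
    and g :: "'m metric"
    and L :: "'m curve set"
    and h :: "'m \<Rightarrow> real"
    and \<Omega> :: "'m set"
  assumes "lorentzian_manifold A g"
    and "geodesic_family A g L"
    and "smooth_fun A h"
    and "\<forall>p. h p > 0"
    and "open \<Omega>"
    and "\<forall>p. p \<notin> \<Omega> \<longrightarrow> h p = 1"
  shows "(\<forall>\<gamma> I. (\<gamma>, I) \<in> L \<longrightarrow> (\<exists>s \<gamma>' I'. conformal_reparam h s (\<gamma>, I) (\<gamma>', I')))
    \<and> (\<forall>\<gamma> I s \<gamma>' I'. (\<gamma>, I) \<in> L \<and> conformal_reparam h s (\<gamma>, I) (\<gamma>', I') \<longrightarrow>
          null_geodesic A (conformal h g) (\<gamma>', I')
          \<and> (\<forall>\<tau>\<in>I. velocity A \<gamma>' (s \<tau>) = tscale (1 / h (\<gamma> \<tau>)) (velocity A \<gamma> \<tau>)))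
    \<and> (\<forall>p. velocity_set A (conformal_family h L) p = {tscale (1 / h p) u | u. u \<in> velocity_set A L p}
          \<and> vol A (conformal h g) (conformal_family h L) p = h p * vol A g (conformal_family h L) p
          \<and> h p * vol A g (conformal_family h L) p = 1 / h p * vol A g L p
          \<and> kappa_vol A (conformal h g) (conformal_family h L) p = h p * kappa_vol A g L p
          \<and> kappa A (conformal h g) (conformal_family h L) p = h p * kappa A g L p)"
proof (intro conjI allI impI)
  note g = assms(1) and h = assms(3) and pos = assms(4)
  note A = lorentzian_smooth_atlas[OF g]
  note null = geodesic_familyD(1)[OF assms(2)]
  {
    fix \<gamma> I assume "(\<gamma>, I) \<in> L"
    then have sm: "smooth_curve A (\<gamma>, I)"
      using null geodesicD(1) unfolding null_geodesic_def by blast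
    show "\<exists>s \<gamma>' I'. conformal_reparam h s (\<gamma>, I) (\<gamma>', I')"
      by (rule conformal_reparam_exists[OF smooth_curveD(2,3)[OF sm] smooth_fun_continuous_on_curve[OF A h sm] pos])
  next
    fix \<gamma> I s \<gamma>' I' assume *: "(\<gamma>, I) \<in> L \<and> conformal_reparam h s (\<gamma>, I) (\<gamma>', I')"
    note C = conformal_reparam_null_geodesic[OF g h pos null[OF conjunct1[OF *]] conjunct2[OF *]]
    show "null_geodesic A (conformal h g) (\<gamma>', I')" by (rule C(1))
    show "\<forall>\<tau>\<in>I. velocity A \<gamma>' (s \<tau>) = tscale (1 / h (\<gamma> \<tau>)) (velocity A \<gamma> \<tau>)"
      using C(2) by blast
  }
  fix p
  let ?L = "conformal_family h L" and ?S = "velocity_set A L p" and ?a = "1 / h p"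
  have hp: "h p > 0" and a: "?a \<noteq> 0" using pos by (auto simp: less_imp_neq[symmetric])
  show V: "velocity_set A ?L p = {tscale ?a u | u. u \<in> ?S}"
    by (rule velocity_set_conformal_family[OF g h pos null])
  then have V': "velocity_set A ?L p = tscale ?a ` ?S" by blast
  note S = geodesic_familyD(2,3)[OF assms(2), of p]
  note b = lorentzian_tangent_form[OF g, of p]
  have conf: "conformal h g p = (\<lambda>u v. h p * g p u v)" by (simp add: conformal_def)
  have r: "h p * ?a\<^sup>2 = ?a" using hp by (simp add: power2_eq_square)
  have vol': "vol A (conformal h g) ?L p = ?a * vol A g L p"
    unfolding vol_def V' conf measure_volume_measure_tscale[OF A S(1) b a hp] r ..
  \<comment> \<open>The surface is rescaled but still measured by the old metric, hence k = 1 and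
    the factor 1/h(p)^2.\<close>
  have vol1: "vol A g ?L p = ?a\<^sup>2 * vol A g L p"
    using measure_volume_measure_tscale[OF A S(1) b a zero_less_one] by (simp add: vol_def V')
  show "vol A (conformal h g) ?L p = h p * vol A g ?L p"
    unfolding vol' vol1 using r by (simp add: mult.assoc[symmetric])
  show "h p * vol A g ?L p = ?a * vol A g L p"
    unfolding vol1 using r by (simp add: mult.assoc[symmetric])
  show "kappa_vol A (conformal h g) ?L p = h p * kappa_vol A g L p"
    by (simp add: kappa_vol_def vol')
  let ?K = "gauss_curvature A p (g p) ?S" and ?\<mu> = "volume_measure A p (g p) ?S"
  \<comment> \<open>The first factor 1/h(p) comes from the measure. The second comes from the
    integrand: the curvature is multiplied by h(p), so its reciprocal is divided by h(p).\<close>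
  have "(\<integral>u. 1 / gauss_curvature A p (conformal h g p) (velocity_set A ?L p) u
        \<partial>volume_measure A p (conformal h g p) (velocity_set A ?L p))
      = ?a * (\<integral>u. 1 / gauss_curvature A p (conformal h g p) (tscale ?a ` ?S) (tscale ?a u) \<partial>?\<mu>)"
    unfolding V' conf volume_measure_tscale[OF A S(1) b a hp] r
    by (rule scaled_measure_basic(4)[OF volume_measure_space_sets a]) (use hp in simp)
  also have "\<dots> = ?a * (\<integral>u. ?a * (1 / ?K u) \<partial>?\<mu>)"
    using hp unfolding conf gauss_curvature_tscale[OF A S(1) b S(2) a less_imp_neq[OF hp, symmetric]] r by (simp add: mult.commute)
  also have "\<dots> = ?a * ?a * (\<integral>u. 1 / ?K u \<partial>?\<mu>)"
    by (simp only: integral_mult_right_zero mult.assoc)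
  finally have int: "(\<integral>u. 1 / gauss_curvature A p (conformal h g p) (velocity_set A ?L p) u
        \<partial>volume_measure A p (conformal h g p) (velocity_set A ?L p)) = ?a * ?a * (\<integral>u. 1 / ?K u \<partial>?\<mu>)" .
  \<comment> \<open>Here c, v and j stand for 8 pi, the area and the integral. When one of them is 0
    the identity still holds, as both sides are 0 by the convention for division by zero.\<close>
  have "1 / (c / (?a * v) * (?a * ?a * j)) = h p * (1 / (c / v * j))" for c v j :: real
    using hp by (cases "c = 0 \<or> v = 0 \<or> j = 0") (auto simp: field_simps)
  then show "kappa A (conformal h g) ?L p = h p * kappa A g L p"
    unfolding kappa_def vol' int .
qed

end
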